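(* Let $k$ be a field and $X=X_0\cup X_1$ a well-ordered set. There is a unique reduced Gröbner–Shirshov basis for every graded ideal of the free Leibniz superalgebra $\mathrm{Lb}_s(X)$ generated by $X=X_0\cup X_1$ (in particular, when $X=X_0$, for every ideal of the free Leibniz algebra generated by $X$).
   Context: Superalgebras. $k$ is a field. A superalgebra is a $k$-vector space $\mathcal A=\mathcal A_0\oplus\mathcal A_1$ with a bilinear product $(xy)$ such that $(\mathcal A_i\mathcal A_j)\subseteq\mathcal A_{i+j}$ (indices in $\mathbb Z_2$); $|x|=i$ for $x\in\mathcal A_i$. It is a Leibniz superalgebra if $(x(yz))=((xy)z)-(-1)^{|z||y|}((xz)y)$ for all homogeneous $x,y,z$; a Leibniz algebra is a Leibniz superalgebra with $\mathcal A=\mathcal A_0$. Ideals are two-sided; an ideal $I$ is graded if $I=(I\cap\mathcal A_0)\oplus(I\cap\mathcal A_1)$. Free Leibniz superalgebra. $X=X_0\cup X_1$ (disjoint) is a nonempty well-ordered set, elements of $X_i$ having parity $i$; $\mathrm{Lb}_s(X)$ is the free Leibniz superalgebra over $k$ on $X$. $[f_1\cdots f_n]_L:=((\cdots((f_1f_2)f_3)\cdots)f_n)$. The set $\mathrm{NF}(X)=\{[a_1\cdots a_n]_L\mid a_i\in X,\ n\ge 1\}$ is a linear basis of $\mathrm{Lb}_s(X)$; $\ell([a_1\cdots a_n]_L)=n$, parity $\sum|a_i|$ mod 2. Order. A map $\deg:X\to\mathbb Z_{>0}$ is fixed, $\deg([a_1\cdots a_n]_L)=\sum\deg(a_i)$;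 $\mathrm{NF}(X)$ is well-ordered by $\mu<\nu$ iff $(\deg\mu,\ell(\mu),a_1,\dots,a_n)<(\deg\nu,\ell(\nu),b_1,\dots,b_m)$ lexicographically, where $\mu=[a_1\cdots a_n]_L$, $\nu=[b_1\cdots b_m]_L$. $\overline f$ is the leading (largest) monomial of $f\neq0$; $f$ is monic if $\overline f$ has coefficient $1$; $\mathrm{supp}(f)$ is the set of elements of $\mathrm{NF}(X)$ occurring in $f$ with nonzero coefficient; $f$ is homogeneous if all its monomials have the same parity. Gröbner–Shirshov bases. Let $S$ be a monic homogeneous set, $s\in S$, $a_1,\dots,a_m\in X$, $m\ge0$. Normal $S$-polynomials are (1) $[sa_1\cdots a_m]_L$, and (2) $[a_1\cdots a_tsa_{t+1}\cdots a_m]_L$ if $\ell(\overline s)=1$, $1\le t\le m$; notation $h_s$. $\mathrm{Irr}(S)=\{\mu\in\mathrm{NF}(X)\mid\mu\ne\overline{h_s}$ for every normal $S$-polynomial $h_s\}$. An element is trivial modulo $(S,\mu)$ (resp. $(S,n)$) if it is a linear combination of normal $S$-polynomials with leading monomials $<\mu$ (resp. of degree $\le n$). $S$ is a Gröbner–Shirshov basis in $\mathrm{Lb}_s(X)$ if: for all $f\neq g$ in $S$ with $\overline f=\overline{h_g}$ for a normal $S$-polynomial $h_g$, $f-h_g$ is trivial modulo $(S,\overline f)$; and for all $f\in S$ with $\ell(\overline f)>1$ and $\mu\in\mathrm{NF}(X)$ with $(\mu f)\neq0$, $(\mu f)$ is trivial modulo $(S,\deg\mu+\deg\overline f)$. $S$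 is reduced if $\mathrm{supp}(s)\subseteq\mathrm{Irr}(S\setminus\{s\})$ for all $s\in S$. A reduced Gröbner–Shirshov basis for a graded ideal $I$ is a monic homogeneous set $S$ with $\mathrm{Id}(S)=I$ (the ideal generated by $S$) that is a reduced Gröbner–Shirshov basis in $\mathrm{Lb}_s(X)$; the empty set is the basis of the zero ideal. *)

theory Defs
  imports Complex_Main "HOL-Library.Poly_Mapping" "HOL-Library.Z2"
begin

section \<open>Superalgebras\<close>

text \<open>Parities are elements of the two-element field \<^typ>\<open>bit\<close>, so that \<open>i + j\<close> is addition
  modulo 2; \<open>koszul i j\<close> is the sign $(-1)^{ij}$.\<close>

definition koszul :: "bit \<Rightarrow> bit \<Rightarrow> 'k::field" where
  "koszul i j = (if i = 1 \<and> j = 1 then - 1 else 1)"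

locale superalgebra = vector_space scale
  for scale :: "'k::field \<Rightarrow> 'a::ab_group_add \<Rightarrow> 'a" +
  fixes mult :: "'a \<Rightarrow> 'a \<Rightarrow> 'a"
    and part :: "bit \<Rightarrow> 'a set"
  assumes mult_linear_left: "Vector_Spaces.linear scale scale (\<lambda>x. mult x y)"
    and mult_linear_right: "Vector_Spaces.linear scale scale (\<lambda>y. mult x y)"
    and part_subspace: "subspace (part i)"
    and part_sum: "\<exists>u\<in>part 0. \<exists>v\<in>part 1. x = u + v"
    and part_Int: "part 0 \<inter> part 1 = {0}"
    and part_mult: "x \<in> part i \<Longrightarrow> y \<in> part j \<Longrightarrow> mult x y \<in> part (i + j)"
begin

definition ideal :: "'a set \<Rightarrow> bool" where
  "ideal I \<longleftrightarrow> subspace I \<and> (\<forall>x\<in>I. \<forall>y. mult x y \<in> I \<and> mult y x \<in> I)"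

definition graded_ideal :: "'a set \<Rightarrow> bool" where
  "graded_ideal I \<longleftrightarrow> ideal I \<and> I = {u + v | u v. u \<in> I \<inter> part 0 \<and> v \<in> I \<inter> part 1}"

definition ideal_generated :: "'a set \<Rightarrow> 'a set" where
  "ideal_generated S = ideal hull S"

end

locale leibniz_superalgebra = superalgebra +
  assumes leibniz: "x \<in> part i \<Longrightarrow> y \<in> part j \<Longrightarrow> z \<in> part l \<Longrightarrow>
    mult x (mult y z) = mult (mult x y) z - scale (koszul l j) (mult (mult x z) y)"


section \<open>The free Leibniz superalgebra\<close>

text \<open>The type \<open>'x nf\<close> is the set NF(X) of left-normed monomials: \<open>Letter a\<close> is the generator
  \<open>a\<close> and \<open>Snoc \<mu> a\<close> is the product $(\mu a)$.\<close>

datatype 'x nf = Letter 'x | Snoc "'x nf" 'x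

primrec letters :: "'x nf \<Rightarrow> 'x list" where
  "letters (Letter a) = [a]"
| "letters (Snoc \<mu> a) = letters \<mu> @ [a]"

definition nf_length :: "'x nf \<Rightarrow> nat" where
  "nf_length \<mu> = length (letters \<mu>)"

definition nf_parity :: "('x \<Rightarrow> bit) \<Rightarrow> 'x nf \<Rightarrow> bit" where
  "nf_parity p \<mu> = sum_list (map p (letters \<mu>))"

text \<open>The underlying vector space is the space of finitely supported functions on NF(X).\<close>

type_synonym ('x, 'k) lb = "'x nf \<Rightarrow>\<^sub>0 'k"

definition lb_scale :: "'k::field \<Rightarrow> ('x, 'k) lb \<Rightarrow> ('x, 'k) lb" where
  "lb_scale c f = Poly_Mapping.map ((*) c) f"

definition mon :: "'x nf \<Rightarrow> ('x, 'k::field) lb" where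
  "mon \<mu> = Poly_Mapping.single \<mu> 1"

definition gen :: "'x \<Rightarrow> ('x, 'k::field) lb" where
  "gen a = mon (Letter a)"

definition lin_ext :: "('k::field \<Rightarrow> 'a \<Rightarrow> 'a) \<Rightarrow> ('x nf \<Rightarrow> 'a) \<Rightarrow> ('x, 'k) lb \<Rightarrow> 'a::ab_group_add" where
  "lin_ext scale \<phi> f = (\<Sum>\<mu>\<in>Poly_Mapping.keys f. scale (Poly_Mapping.lookup f \<mu>) (\<phi> \<mu>))"

text \<open>The second equation is the Leibniz identity for $(\mu(\nu b))$. That this
  yields the free Leibniz superalgebra is the theorem \<open>lb_free\<close> below.\<close>

primrec nf_mult :: "('x \<Rightarrow> bit) \<Rightarrow> 'x nf \<Rightarrow> 'x nf \<Rightarrow> ('x, 'k::field) lb" where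
  "nf_mult p \<mu> (Letter b) = mon (Snoc \<mu> b)"
| "nf_mult p \<mu> (Snoc \<nu> b) =
     lin_ext lb_scale (\<lambda>\<kappa>. mon (Snoc \<kappa> b)) (nf_mult p \<mu> \<nu>)
       - lb_scale (koszul (p b) (nf_parity p \<nu>)) (nf_mult p (Snoc \<mu> b) \<nu>)"

definition lb_mult :: "('x \<Rightarrow> bit) \<Rightarrow> ('x, 'k::field) lb \<Rightarrow> ('x, 'k) lb \<Rightarrow> ('x, 'k) lb" where
  "lb_mult p f g = lin_ext lb_scale (\<lambda>\<mu>. lin_ext lb_scale (nf_mult p \<mu>) g) f"

definition lb_part :: "('x \<Rightarrow> bit) \<Rightarrow> bit \<Rightarrow> ('x, 'k::field) lb set" where
  "lb_part p i = {f. \<forall>\<mu>\<in>Poly_Mapping.keys f. nf_parity p \<mu> = i}"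

lemma lookup_lb_scale [simp]:
  "Poly_Mapping.lookup (lb_scale c f) \<mu> = c * Poly_Mapping.lookup f \<mu>"
  by (simp add: lb_scale_def Poly_Mapping.map.rep_eq when_def)

global_interpretation lb: vector_space lb_scale
  by unfold_locales
     (auto intro!: poly_mapping_eqI simp: lookup_add algebra_simps)

lemma linI:
  assumes "vector_space scale" "\<And>x y. F (x + y) = F x + F y"
    and "\<And>c x. F (lb_scale c x) = scale c (F x)"
  shows "Vector_Spaces.linear lb_scale scale F"
  using assms lb.vector_space_axioms by (auto simp: Vector_Spaces.linear_iff)

lemma lin_ext_superset:
  assumes "vector_space scale" "finite K" "Poly_Mapping.keys f \<subseteq> K"
  shows "lin_ext scale \<phi> f = (\<Sum>\<mu>\<in>K. scale (Poly_Mapping.lookup f \<mu>) (\<phi> \<mu>))"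
proof -
  interpret vector_space scale by fact
  show ?thesis unfolding lin_ext_def
    by (rule sum.mono_neutral_left) (use assms in \<open>auto simp: in_keys_iff\<close>)
qed

lemma lin_ext_linear:
  assumes "vector_space scale"
  shows "Vector_Spaces.linear lb_scale scale (lin_ext scale \<phi>)"
proof -
  interpret V: vector_space scale by fact
  show ?thesis
  proof (rule linI[OF assms])
    fix f g :: "('c, 'a) lb"
    let ?K = "Poly_Mapping.keys f \<union> Poly_Mapping.keys g"
    have k: "Poly_Mapping.keys (f + g) \<subseteq> ?K" by (rule Poly_Mapping.keys_add)
    show "lin_ext scale \<phi> (f + g) = lin_ext scale \<phi> f + lin_ext scale \<phi> g"
      using k by (simp add: lin_ext_superset[OF assms, of ?K] lookup_add
          V.scale_left_distrib sum.distrib)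
  next
    fix c and f :: "('c, 'a) lb"
    have k: "Poly_Mapping.keys (lb_scale c f) \<subseteq> Poly_Mapping.keys f" by (auto simp: in_keys_iff)
    show "lin_ext scale \<phi> (lb_scale c f) = scale c (lin_ext scale \<phi> f)"
      using k by (simp add: lin_ext_superset[OF assms, of "Poly_Mapping.keys f"]
          V.scale_sum_right)
  qed
qed

lemma lin_ext_mono:
  assumes "vector_space scale"
  shows "lin_ext scale \<phi> (mon \<mu>) = \<phi> \<mu>"
proof -
  interpret vector_space scale by fact
  show ?thesis by (simp add: lin_ext_def mon_def)
qed

lemma lb_expand: "f = (\<Sum>\<mu>\<in>Poly_Mapping.keys f. lb_scale (Poly_Mapping.lookup f \<mu>) (mon \<mu>))"
  by (rule poly_mapping_eqI)
     (auto simp: Poly_Mapping.lookup_sum mon_def lookup_single when_def in_keys_iff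
       if_distrib sum.delta cong: if_cong)

lemma linear_expand:
  assumes "Vector_Spaces.linear lb_scale scale F"
  shows "F f = lin_ext scale (\<lambda>\<mu>. F (mon \<mu>)) f"
proof -
  interpret Vector_Spaces.linear lb_scale scale F by fact
  have "F f = F (\<Sum>\<mu>\<in>Poly_Mapping.keys f. lb_scale (Poly_Mapping.lookup f \<mu>) (mon \<mu>))"
    by (simp add: lb_expand[symmetric])
  then show ?thesis by (simp add: lin_ext_def sum scale)
qed

lemma linear_eqI:
  assumes "Vector_Spaces.linear lb_scale scale F" "Vector_Spaces.linear lb_scale scale G"
    and "\<And>\<mu>. \<mu> \<in> Poly_Mapping.keys f \<Longrightarrow> F (mon \<mu>) = G (mon \<mu>)"
  shows "F f = G f"
  unfolding linear_expand[OF assms(1), of f] linear_expand[OF assms(2), of f] lin_ext_def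
  by (rule sum.cong) (simp_all add: assms(3))

global_interpretation lbp: vector_space_pair lb_scale lb_scale
  by unfold_locales

lemmas lb_lin_ext_linear = lin_ext_linear[OF lb.vector_space_axioms]
lemmas lb_lin_ext_mono [simp] = lin_ext_mono[OF lb.vector_space_axioms]

lemma lb_mult_linear_left: "Vector_Spaces.linear lb_scale lb_scale (\<lambda>f. lb_mult p f g)"
  unfolding lb_mult_def by (rule lb_lin_ext_linear)

lemma lb_mult_linear_right: "Vector_Spaces.linear lb_scale lb_scale (\<lambda>g. lb_mult p f g)"
  unfolding lb_mult_def lin_ext_def[of _ _ f]
  by (rule linI[OF lb.vector_space_axioms])
     (simp_all add: lbp.linear_add[OF lb_lin_ext_linear] lbp.linear_scale[OF lb_lin_ext_linear]
       lb.scale_right_distrib sum.distrib lb.scale_sum_right mult.commute)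

lemma lb_mult_mono: "lb_mult p (mon \<mu>) (mon \<nu>) = nf_mult p \<mu> \<nu>"
  by (simp add: lb_mult_def)

lemmas lb_mult_simps =
  lbp.linear_add[OF lb_mult_linear_left] lbp.linear_add[OF lb_mult_linear_right]
  lbp.linear_diff[OF lb_mult_linear_left] lbp.linear_diff[OF lb_mult_linear_right]
  lbp.linear_scale[OF lb_mult_linear_left] lbp.linear_scale[OF lb_mult_linear_right]

lemma lb_mult_gen: "lb_mult p f (gen b) = lin_ext lb_scale (\<lambda>\<kappa>. mon (Snoc \<kappa> b)) f"
  by (rule linear_eqI[OF lb_mult_linear_left lb_lin_ext_linear]) (simp add: gen_def lb_mult_mono)

lemma mono_Snoc: "mon (Snoc \<mu> b) = lb_mult p (mon \<mu>) (gen b)"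
  by (simp add: lb_mult_gen)

lemma lb_mult_mono_Snoc:
  "lb_mult p f (mon (Snoc \<nu> b)) = lb_mult p (lb_mult p f (mon \<nu>)) (gen b)
     - lb_scale (koszul (p b) (nf_parity p \<nu>)) (lb_mult p (lb_mult p f (gen b)) (mon \<nu>))"
  (is "?F f = ?G f - ?H f")
proof (rule linear_eqI[where F = ?F and G = "\<lambda>f. ?G f - ?H f"])
  show "Vector_Spaces.linear lb_scale lb_scale ?F" by (rule lb_mult_linear_left)
  show "Vector_Spaces.linear lb_scale lb_scale (\<lambda>f. ?G f - ?H f)"
    by (rule linI[OF lb.vector_space_axioms]) (simp_all add: lb_mult_simps algebra_simps lb.scale_right_distrib
        lb.scale_right_diff_distrib)
  show "?F (mon \<mu>) = ?G (mon \<mu>) - ?H (mon \<mu>)" for \<mu>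
    by (simp add: lb_mult_mono lb_mult_gen)
qed

lemma nf_parity_simps [simp]:
  "nf_parity p (Letter a) = p a" "nf_parity p (Snoc \<mu> a) = nf_parity p \<mu> + p a"
  by (simp_all add: nf_parity_def)

lemma lb_part_subspace: "lb.subspace (lb_part p i)"
proof (rule lb.subspaceI)
  show "x + y \<in> lb_part p i" if "x \<in> lb_part p i" "y \<in> lb_part p i" for x y
    using that Poly_Mapping.keys_add[of x y] by (auto simp: lb_part_def)
qed (auto simp: lb_part_def in_keys_iff)

lemma mono_part: "mon \<mu> \<in> lb_part p (nf_parity p \<mu>)"
  by (simp add: lb_part_def mon_def)

lemma lin_ext_in_subspace:
  assumes "vector_space scale" "module.subspace scale U"
    and "\<And>\<mu>. \<mu> \<in> Poly_Mapping.keys f \<Longrightarrow> \<phi> \<mu> \<in> U"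
  shows "lin_ext scale \<phi> f \<in> U"
proof -
  interpret vector_space scale by fact
  show ?thesis unfolding lin_ext_def
    by (intro subspace_sum subspace_scale assms(2,3))
qed

lemma nf_mult_part:
  fixes p :: "'a \<Rightarrow> bit"
  shows "(nf_mult p \<mu> \<nu> :: ('a, 'b::field) lb) \<in> lb_part p (nf_parity p \<mu> + nf_parity p \<nu>)"
proof (induction \<nu> arbitrary: \<mu>)
  case (Letter b)
  show ?case using mono_part[of "Snoc \<mu> b" p] by simp
next
  case (Snoc \<nu> b)
  have "lin_ext lb_scale (\<lambda>\<kappa>. mon (Snoc \<kappa> b)) (nf_mult p \<mu> \<nu> :: ('a, 'b) lb)
      \<in> lb_part p (nf_parity p \<mu> + nf_parity p (Snoc \<nu> b))"
  proof (rule lin_ext_in_subspace[OF lb.vector_space_axioms lb_part_subspace])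
    fix \<kappa> assume "\<kappa> \<in> Poly_Mapping.keys (nf_mult p \<mu> \<nu> :: ('a, 'b) lb)"
    then have "nf_parity p \<kappa> = nf_parity p \<mu> + nf_parity p \<nu>"
      using Snoc[of \<mu>] by (auto simp: lb_part_def)
    then show "(mon (Snoc \<kappa> b) :: ('a, 'b) lb) \<in> lb_part p (nf_parity p \<mu> + nf_parity p (Snoc \<nu> b))"
      using mono_part[of "Snoc \<kappa> b" p] by (simp only: nf_parity_simps add.assoc)
  qed
  moreover have "(nf_mult p (Snoc \<mu> b) \<nu> :: ('a, 'b) lb) \<in> lb_part p (nf_parity p \<mu> + nf_parity p (Snoc \<nu> b))"
    using Snoc[of "Snoc \<mu> b"] by (simp only: nf_parity_simps ac_simps)
  ultimately show ?case
    by (simp del: nf_parity_simps add: lb.subspace_diff lb.subspace_scale lb_part_subspace)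
qed

lemma lb_mult_part:
  assumes "f \<in> lb_part p i" "g \<in> lb_part p j"
  shows "lb_mult p f g \<in> lb_part p (i + j)"
  unfolding lb_mult_def
proof (intro lin_ext_in_subspace[OF lb.vector_space_axioms lb_part_subspace])
  fix \<mu> \<nu> assume "\<mu> \<in> Poly_Mapping.keys f" "\<nu> \<in> Poly_Mapping.keys g"
  then show "nf_mult p \<mu> \<nu> \<in> lb_part p (i + j)"
    using assms nf_mult_part[of p \<mu> \<nu>] by (auto simp: lb_part_def)
qed

lemma bit_eq_0_or_1: "(i::bit) = 0 \<or> i = 1"
  by (cases "i = 0") auto

lemma lb_part_sum: "\<exists>u\<in>lb_part p 0. \<exists>v\<in>lb_part p 1. f = u + v"
proof -
  define h where "h i = lin_ext lb_scale (\<lambda>\<mu>. if nf_parity p \<mu> = i then mon \<mu> else 0) f" for i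
  have part: "h i \<in> lb_part p i" for i
    unfolding h_def using mono_part lb.subspace_0[OF lb_part_subspace]
    by (intro lin_ext_in_subspace[OF lb.vector_space_axioms lb_part_subspace])
       (auto intro: mono_part)
  have "f = (\<Sum>\<mu>\<in>Poly_Mapping.keys f. lb_scale (Poly_Mapping.lookup f \<mu>) (mon \<mu>))"
    by (rule lb_expand)
  also have "\<dots> = h 0 + h 1"
    unfolding h_def lin_ext_def sum.distrib[symmetric]
    by (rule sum.cong) auto
  finally show ?thesis using part by blast
qed

lemma lb_leibniz_mono:
  "lb_mult p x (lb_mult p (mon \<mu>) (mon \<nu>)) = lb_mult p (lb_mult p x (mon \<mu>)) (mon \<nu>)
     - lb_scale (koszul (nf_parity p \<nu>) (nf_parity p \<mu>)) (lb_mult p (lb_mult p x (mon \<nu>)) (mon \<mu>))"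
proof (induction \<nu> arbitrary: x \<mu>)
  case (Letter b)
  show ?case
    using lb_mult_mono_Snoc[of p x \<mu> b] by (simp add: mono_Snoc[of \<mu> b p] gen_def)
next
  case (Snoc \<nu> b)
  let ?m = "lb_mult p"
  let ?n = "mon \<nu>" and ?u = "mon \<mu>" and ?b = "gen b"
  have gen: "?m x (?m g ?b) = ?m (?m x g) ?b - lb_scale (koszul (p b) j) (?m (?m x ?b) g)"
    if "g \<in> lb_part p j" for g j and x :: "('a, 'b) lb"
  proof (rule linear_eqI[where F = "\<lambda>g. ?m x (?m g ?b)" and
        G = "\<lambda>g. ?m (?m x g) ?b - lb_scale (koszul (p b) j) (?m (?m x ?b) g)"])
    show "Vector_Spaces.linear lb_scale lb_scale (\<lambda>g. ?m x (?m g ?b))"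
      by (rule linI[OF lb.vector_space_axioms]) (simp_all add: lb_mult_simps)
    show "Vector_Spaces.linear lb_scale lb_scale
        (\<lambda>g. ?m (?m x g) ?b - lb_scale (koszul (p b) j) (?m (?m x ?b) g))"
      by (rule linI[OF lb.vector_space_axioms]) (simp_all add: lb_mult_simps algebra_simps lb.scale_right_distrib
          lb.scale_right_diff_distrib)
    fix \<kappa> assume "\<kappa> \<in> Poly_Mapping.keys g"
    then have "nf_parity p \<kappa> = j" using that by (auto simp: lb_part_def)
    then show "?m x (?m (mon \<kappa>) ?b) =
        ?m (?m x (mon \<kappa>)) ?b - lb_scale (koszul (p b) j) (?m (?m x ?b) (mon \<kappa>))"
      using lb_mult_mono_Snoc[of p x \<kappa> b] by (simp add: mono_Snoc[of \<kappa> b p])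
  qed
  have un: "?m ?u ?n \<in> lb_part p (nf_parity p \<mu> + nf_parity p \<nu>)"
    by (intro lb_mult_part mono_part)
  show ?case
    unfolding lb_mult_mono_Snoc[of p _ \<nu> b] lb_mult_simps gen[OF un]
      mono_Snoc[of \<mu> b p, symmetric] Snoc
    unfolding mono_Snoc[of \<mu> b p] gen[OF mono_part] lb_mult_simps Snoc
    using bit_eq_0_or_1[of "p b"] bit_eq_0_or_1[of "nf_parity p \<mu>"] bit_eq_0_or_1[of "nf_parity p \<nu>"]
    by (elim disjE) (simp_all add: koszul_def lb_mult_simps algebra_simps)
qed

lemma lb_leibniz:
  assumes "y \<in> lb_part p j" "z \<in> lb_part p l"
  shows "lb_mult p x (lb_mult p y z) = lb_mult p (lb_mult p x y) z
     - lb_scale (koszul l j) (lb_mult p (lb_mult p x z) y)"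
proof -
  let ?m = "lb_mult p"
  have lin: "Vector_Spaces.linear lb_scale lb_scale (\<lambda>y. ?m x (?m y z))"
    "Vector_Spaces.linear lb_scale lb_scale (\<lambda>y. ?m (?m x y) z - lb_scale (koszul l j) (?m (?m x z) y))"
    "Vector_Spaces.linear lb_scale lb_scale (\<lambda>z. ?m x (?m y z))"
    "Vector_Spaces.linear lb_scale lb_scale (\<lambda>z. ?m (?m x y) z - lb_scale (koszul l j) (?m (?m x z) y))"
    for y z
    by (rule linI[OF lb.vector_space_axioms]; simp add: lb_mult_simps algebra_simps lb.scale_right_distrib
        lb.scale_right_diff_distrib)+
  show ?thesis
  proof (rule linear_eqI[OF lin(1,2)], rule linear_eqI[OF lin(3,4)])
    fix \<mu> \<nu> assume "\<mu> \<in> Poly_Mapping.keys y" "\<nu> \<in> Poly_Mapping.keys z"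
    then have "nf_parity p \<mu> = j" "nf_parity p \<nu> = l"
      using assms by (auto simp: lb_part_def)
    then show "?m x (?m (mon \<mu>) (mon \<nu>)) =
        ?m (?m x (mon \<mu>)) (mon \<nu>) - lb_scale (koszul l j) (?m (?m x (mon \<nu>)) (mon \<mu>))"
      using lb_leibniz_mono[of p x \<mu> \<nu>] by simp
  qed
qed

theorem lb_leibniz_superalgebra: "leibniz_superalgebra lb_scale (lb_mult p) (lb_part p)"
proof unfold_locales
  show "lb_part p 0 \<inter> lb_part p 1 = {0}"
  proof (intro equalityI subsetI)
    fix f assume "f \<in> lb_part p 0 \<inter> lb_part p 1"
    then have "Poly_Mapping.keys f = {}" by (force simp: lb_part_def)
    then show "f \<in> {0}" by simp
  qed (simp add: lb_part_def)
qed (simp_all only: lb_mult_linear_left lb_mult_linear_right lb_part_subspace lb_part_sum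
      lb_mult_part lb_leibniz lb_mult_simps)

text \<open>When all generators are even, the odd part vanishes, so the superalgebra is a Leibniz algebra
  and \<open>lb_free\<close> makes it the free one.\<close>

lemma lb_part_even:
  assumes "\<And>x. p x = 0"
  shows "lb_part p 0 = UNIV"
proof -
  have "nf_parity p \<mu> = 0" for \<mu>
    by (induction \<mu>) (simp_all add: assms)
  then show ?thesis by (simp add: lb_part_def)
qed

theorem lb_free:
  fixes scale :: "'k::field \<Rightarrow> 'a::ab_group_add \<Rightarrow> 'a" and \<iota> :: "'x \<Rightarrow> 'a"
  assumes B: "leibniz_superalgebra scale mult part" and \<iota>: "\<And>x. \<iota> x \<in> part (p x)"
  shows "\<exists>!\<phi>. Vector_Spaces.linear lb_scale scale \<phi> \<and>
    (\<forall>f g. \<phi> (lb_mult p f g) = mult (\<phi> f) (\<phi> g)) \<and>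
    (\<forall>i. \<phi> ` lb_part p i \<subseteq> part i) \<and> (\<forall>x. \<phi> (gen x) = \<iota> x)"
proof -
  interpret B: leibniz_superalgebra scale mult part by fact
  interpret P: vector_space_pair lb_scale scale by unfold_locales
  interpret Q: vector_space_pair scale scale by unfold_locales
  note B_simps = Q.linear_add[OF B.mult_linear_left] Q.linear_add[OF B.mult_linear_right]
    Q.linear_diff[OF B.mult_linear_left] Q.linear_diff[OF B.mult_linear_right]
    Q.linear_scale[OF B.mult_linear_left] Q.linear_scale[OF B.mult_linear_right]
  define e where "e = rec_nf \<iota> (\<lambda>_ b u. mult u (\<iota> b))"
  have e: "e (Letter b) = \<iota> b" "e (Snoc \<mu> b) = mult (e \<mu>) (\<iota> b)" for \<mu> b
    by (simp_all add: e_def)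
  define \<phi> where "\<phi> = lin_ext scale e"
  have lin: "Vector_Spaces.linear lb_scale scale \<phi>"
    unfolding \<phi>_def by (rule lin_ext_linear[OF B.vector_space_axioms])
  note \<phi>_simps = P.linear_add[OF lin] P.linear_diff[OF lin] P.linear_scale[OF lin]
  have \<phi>_mon: "\<phi> (mon \<mu>) = e \<mu>" for \<mu>
    by (simp add: \<phi>_def lin_ext_mono[OF B.vector_space_axioms])
  have e_part: "e \<mu> \<in> part (nf_parity p \<mu>)" for \<mu>
    by (induction \<mu>) (simp_all only: e \<iota> nf_parity_simps B.part_mult)
  have \<phi>_part: "\<phi> f \<in> part i" if "f \<in> lb_part p i" for f i
    unfolding \<phi>_def using that e_part
    by (intro lin_ext_in_subspace[OF B.vector_space_axioms B.part_subspace])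
       (auto simp: lb_part_def)
  have \<phi>_gen: "\<phi> (gen x) = \<iota> x" for x
    by (simp add: gen_def \<phi>_mon e)
  have \<phi>_rmul: "\<phi> (lb_mult p f (gen b)) = mult (\<phi> f) (\<iota> b)" for f b
  proof (rule linear_eqI[where F = "\<lambda>f. \<phi> (lb_mult p f (gen b))" and G = "\<lambda>f. mult (\<phi> f) (\<iota> b)"])
    show "Vector_Spaces.linear lb_scale scale (\<lambda>f. \<phi> (lb_mult p f (gen b)))"
      "Vector_Spaces.linear lb_scale scale (\<lambda>f. mult (\<phi> f) (\<iota> b))"
      by (rule linI[OF B.vector_space_axioms]; simp add: \<phi>_simps B_simps lb_mult_simps)+
    show "\<phi> (lb_mult p (mon \<mu>) (gen b)) = mult (\<phi> (mon \<mu>)) (\<iota> b)" for \<mu>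
      by (simp add: mono_Snoc[symmetric] \<phi>_mon e)
  qed
  have \<phi>_nf: "\<phi> (nf_mult p \<mu> \<nu>) = mult (e \<mu>) (e \<nu>)" for \<mu> \<nu>
  proof (induction \<nu> arbitrary: \<mu>)
    case (Letter b)
    show ?case by (simp add: \<phi>_mon e)
  next
    case (Snoc \<nu> b)
    show ?case
      using B.leibniz[OF e_part e_part \<iota>, of \<mu> \<nu> b]
      by (simp add: \<phi>_simps lb_mult_gen[of p, symmetric] \<phi>_rmul Snoc e)
  qed
  have \<phi>_mult: "\<phi> (lb_mult p f g) = mult (\<phi> f) (\<phi> g)" for f g
  proof -
    have lins: "Vector_Spaces.linear lb_scale scale (\<lambda>f. \<phi> (lb_mult p f g))"
      "Vector_Spaces.linear lb_scale scale (\<lambda>f. mult (\<phi> f) (\<phi> g))"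
      "Vector_Spaces.linear lb_scale scale (\<lambda>g. \<phi> (lb_mult p f g))"
      "Vector_Spaces.linear lb_scale scale (\<lambda>g. mult (\<phi> f) (\<phi> g))" for f g
      by (rule linI[OF B.vector_space_axioms]; simp add: \<phi>_simps B_simps lb_mult_simps)+
    show ?thesis
      by (rule linear_eqI[OF lins(1,2)], rule linear_eqI[OF lins(3,4)])
         (simp add: lb_mult_mono \<phi>_nf \<phi>_mon)
  qed
  show ?thesis
  proof (rule ex1I[of _ \<phi>])
    show "Vector_Spaces.linear lb_scale scale \<phi> \<and>
      (\<forall>f g. \<phi> (lb_mult p f g) = mult (\<phi> f) (\<phi> g)) \<and>
      (\<forall>i. \<phi> ` lb_part p i \<subseteq> part i) \<and> (\<forall>x. \<phi> (gen x) = \<iota> x)"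
      using lin \<phi>_mult \<phi>_part \<phi>_gen by auto
  next
    fix \<psi>
    assume \<psi>: "Vector_Spaces.linear lb_scale scale \<psi> \<and>
      (\<forall>f g. \<psi> (lb_mult p f g) = mult (\<psi> f) (\<psi> g)) \<and>
      (\<forall>i. \<psi> ` lb_part p i \<subseteq> part i) \<and> (\<forall>x. \<psi> (gen x) = \<iota> x)"
    have "\<psi> (mon \<mu>) = \<phi> (mon \<mu>)" for \<mu>
      by (induction \<mu>)
         (use \<psi> in \<open>simp_all add: gen_def[symmetric] mono_Snoc[of _ _ p] \<phi>_gen \<phi>_rmul\<close>)
    then have "\<psi> f = \<phi> f" for f
      using linear_eqI[OF conjunct1[OF \<psi>] lin] by blast
    then show "\<psi> = \<phi>" by (rule ext)
  qed
qed


section \<open>Groebner--Shirshov bases\<close>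

text \<open>The product $[f_1 f_2 \cdots f_n]_L$ is \<open>left_normed p f\<^sub>1 [f\<^sub>2, \<dots>, f\<^sub>n]\<close>.\<close>

definition left_normed :: "('x \<Rightarrow> bit) \<Rightarrow> ('x, 'k::field) lb \<Rightarrow> ('x, 'k) lb list \<Rightarrow> ('x, 'k) lb" where
  "left_normed p f fs = foldl (lb_mult p) f fs"

lemma mono_eq_left_normed:
  "mon \<mu> = left_normed p (gen (hd (letters \<mu>))) (map gen (tl (letters \<mu>)))"
proof (induction \<mu>)
  case (Letter a)
  show ?case by (simp add: left_normed_def gen_def)
next
  case (Snoc \<mu> a)
  have "letters \<mu> \<noteq> []" by (cases \<mu>) auto
  then show ?case
    using Snoc by (simp add: left_normed_def mono_Snoc[of \<mu> a p])
qed

definition nf_deg :: "('x \<Rightarrow> nat) \<Rightarrow> 'x nf \<Rightarrow> nat" where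
  "nf_deg d \<mu> = sum_list (map d (letters \<mu>))"

definition nf_less :: "('x::wellorder \<Rightarrow> nat) \<Rightarrow> 'x nf \<Rightarrow> 'x nf \<Rightarrow> bool" where
  "nf_less d \<mu> \<nu> \<longleftrightarrow> nf_deg d \<mu> < nf_deg d \<nu> \<or>
     (nf_deg d \<mu> = nf_deg d \<nu> \<and> (nf_length \<mu> < nf_length \<nu> \<or>
       (nf_length \<mu> = nf_length \<nu> \<and> (letters \<mu>, letters \<nu>) \<in> lexord {(a, b). a < b})))"

definition lead :: "('x::wellorder \<Rightarrow> nat) \<Rightarrow> ('x, 'k::field) lb \<Rightarrow> 'x nf" where
  "lead d f = (THE \<mu>. \<mu> \<in> Poly_Mapping.keys f \<and>
     (\<forall>\<nu>\<in>Poly_Mapping.keys f. \<nu> \<noteq> \<mu> \<longrightarrow> nf_less d \<nu> \<mu>))"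

definition monic :: "('x::wellorder \<Rightarrow> nat) \<Rightarrow> ('x, 'k::field) lb \<Rightarrow> bool" where
  "monic d f \<longleftrightarrow> f \<noteq> 0 \<and> Poly_Mapping.lookup f (lead d f) = 1"

definition homogeneous :: "('x \<Rightarrow> bit) \<Rightarrow> ('x, 'k::field) lb \<Rightarrow> bool" where
  "homogeneous p f \<longleftrightarrow> (\<exists>i. f \<in> lb_part p i)"

definition normal_polys_of ::
    "('x::wellorder \<Rightarrow> bit) \<Rightarrow> ('x \<Rightarrow> nat) \<Rightarrow> ('x, 'k::field) lb \<Rightarrow> ('x, 'k) lb set" where
  "normal_polys_of p d s =
     {left_normed p s (map gen as) | as. True} \<union>
     {left_normed p (gen a) (map gen as @ s # map gen bs) | a as bs. nf_length (lead d s) = 1}"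

definition normal_polys ::
    "('x::wellorder \<Rightarrow> bit) \<Rightarrow> ('x \<Rightarrow> nat) \<Rightarrow> ('x, 'k::field) lb set \<Rightarrow> ('x, 'k) lb set" where
  "normal_polys p d S = (\<Union>s\<in>S. normal_polys_of p d s)"

definition Irr ::
    "('x::wellorder \<Rightarrow> bit) \<Rightarrow> ('x \<Rightarrow> nat) \<Rightarrow> ('x, 'k::field) lb set \<Rightarrow> 'x nf set" where
  "Irr p d S = {\<mu>. \<forall>h\<in>normal_polys p d S. \<mu> \<noteq> lead d h}"

definition trivial_below ::
    "('x::wellorder \<Rightarrow> bit) \<Rightarrow> ('x \<Rightarrow> nat) \<Rightarrow> ('x, 'k::field) lb set \<Rightarrow> 'x nf \<Rightarrow> ('x, 'k) lb \<Rightarrow> bool" where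
  "trivial_below p d S \<mu> f \<longleftrightarrow> f \<in> lb.span {h \<in> normal_polys p d S. nf_less d (lead d h) \<mu>}"

definition trivial_upto_deg ::
    "('x::wellorder \<Rightarrow> bit) \<Rightarrow> ('x \<Rightarrow> nat) \<Rightarrow> ('x, 'k::field) lb set \<Rightarrow> nat \<Rightarrow> ('x, 'k) lb \<Rightarrow> bool" where
  "trivial_upto_deg p d S n f \<longleftrightarrow> f \<in> lb.span {h \<in> normal_polys p d S. nf_deg d (lead d h) \<le> n}"

definition gs_basis ::
    "('x::wellorder \<Rightarrow> bit) \<Rightarrow> ('x \<Rightarrow> nat) \<Rightarrow> ('x, 'k::field) lb set \<Rightarrow> bool" where
  "gs_basis p d S \<longleftrightarrow>
     (\<forall>s\<in>S. monic d s \<and> homogeneous p s) \<and>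
     (\<forall>f\<in>S. \<forall>g\<in>S. f \<noteq> g \<longrightarrow> (\<forall>h\<in>normal_polys_of p d g.
        lead d f = lead d h \<longrightarrow> trivial_below p d S (lead d f) (f - h))) \<and>
     (\<forall>f\<in>S. nf_length (lead d f) > 1 \<longrightarrow> (\<forall>\<mu>. lb_mult p (mon \<mu>) f \<noteq> 0 \<longrightarrow>
        trivial_upto_deg p d S (nf_deg d \<mu> + nf_deg d (lead d f)) (lb_mult p (mon \<mu>) f)))"

definition reduced ::
    "('x::wellorder \<Rightarrow> bit) \<Rightarrow> ('x \<Rightarrow> nat) \<Rightarrow> ('x, 'k::field) lb set \<Rightarrow> bool" where
  "reduced p d S \<longleftrightarrow> (\<forall>s\<in>S. Poly_Mapping.keys s \<subseteq> Irr p d (S - {s}))"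

definition reduced_gs_basis_for ::
    "('x::wellorder \<Rightarrow> bit) \<Rightarrow> ('x \<Rightarrow> nat) \<Rightarrow> ('x, 'k::field) lb set \<Rightarrow> ('x, 'k) lb set \<Rightarrow> bool" where
  "reduced_gs_basis_for p d I S \<longleftrightarrow>
     gs_basis p d S \<and> reduced p d S \<and>
     superalgebra.ideal_generated lb_scale (lb_mult p) S = I"

end

theory Submission
  imports Defs
begin

text \<open>
  Call a leading monomial of a graded ideal \<open>I\<close> minimal if neither its longest proper prefix nor (when
  it is longer than one letter) its last letter is a leading monomial of \<open>I\<close>. For a minimal \<open>\<mu>\<close> there
  is exactly one monic element of \<open>I\<close> with leading monomial \<open>\<mu>\<close> none of whose other monomials is a
  leading monomial of \<open>I\<close>; it is homogeneous because its component of the wrong parity lies in \<open>I\<close>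
  and contains no leading monomial of \<open>I\<close>. These elements form a reduced basis: every leading monomial
  of \<open>I\<close> is that of a normal polynomial, so division expresses each element of \<open>I\<close> by normal
  polynomials that are no larger. Conversely, in a reduced Groebner--Shirshov basis of \<open>I\<close> two normal
  polynomials with the same leading monomial differ by a combination of smaller ones, so the leading
  monomials of \<open>I\<close> are exactly those of the normal polynomials, and reducedness forces the basis to be
  the one just described.
\<close>

section \<open>Left-normed monomials and their order\<close>

lemma letters_nonempty [simp]: "letters \<mu> \<noteq> []"
  by (cases \<mu>) auto

lemma letters_inject: "letters \<mu> = letters \<nu> \<Longrightarrow> \<mu> = \<nu>"
proof (induction \<mu> arbitrary: \<nu>)
  case (Letter a)
  then show ?case by (cases \<nu>) (auto simp: Cons_eq_append_conv)
next
  case (Snoc \<mu> a)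
  then show ?case by (cases \<nu>) auto
qed

lemma nf_deg_simps [simp]:
  "nf_deg d (Letter a) = d a" "nf_deg d (Snoc \<mu> a) = nf_deg d \<mu> + d a"
  by (simp_all add: nf_deg_def)

lemma nf_length_simps [simp]:
  "nf_length (Letter a) = 1" "nf_length (Snoc \<mu> a) = Suc (nf_length \<mu>)"
  by (simp_all add: nf_length_def)

lemma nf_length_pos [simp]: "nf_length \<mu> > 0"
  by (simp add: nf_length_def)

lemma nf_length_1E:
  assumes "nf_length \<mu> = 1"
  obtains b where "\<mu> = Letter b"
  using assms by (cases \<mu>) (auto simp: nf_length_def)

text \<open>\<open>lenlex\<close> compares lengths first, so the order is a pullback of a library
  order and inherits its well-foundedness and transitivity; totality also uses injectivity of
  \<open>letters\<close>.\<close>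

lemma nf_less_lenlex:
  "nf_less d \<mu> \<nu> \<longleftrightarrow>
     (\<mu>, \<nu>) \<in> inv_image (less_than <*lex*> lenlex {(a, b). a < b}) (\<lambda>\<mu>. (nf_deg d \<mu>, letters \<mu>))"
  unfolding nf_less_def nf_length_def by (auto simp: lenlex_conv lexord_lex)

lemma wf_nf_less: "wf {(\<mu>, \<nu>). nf_less d \<mu> (\<nu> :: 'x::wellorder nf)}"
proof -
  have "wf (inv_image (less_than <*lex*> lenlex {(a, b). a < (b::'x)}) (\<lambda>\<mu>. (nf_deg d \<mu>, letters \<mu>)))"
    by (intro wf_inv_image wf_lex_prod wf_lenlex wf) auto
  then show ?thesis by (rule wf_subset) (auto simp: nf_less_lenlex)
qed

lemmas nf_less_induct = wf_induct_rule[OF wf_nf_less, simplified, consumes 0, case_names less]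

lemma nf_less_irrefl [simp]: "\<not> nf_less d \<mu> \<mu>"
  using wf_not_refl[OF wf_nf_less, of \<mu> d] by simp

lemma nf_less_trans: "nf_less d \<mu> \<nu> \<Longrightarrow> nf_less d \<nu> \<kappa> \<Longrightarrow> nf_less d \<mu> \<kappa>"
proof -
  have "trans (lenlex {(a, b). a < (b::'a)})" by (intro lenlex_transI) (auto intro: transI)
  then have "trans (less_than <*lex*> lenlex {(a, b). a < (b::'a)})"
    by (intro trans_lex_prod) auto
  then have "trans (inv_image (less_than <*lex*> lenlex {(a, b). a < (b::'a)})
      (\<lambda>\<mu>. (nf_deg d \<mu>, letters \<mu>)))"
    by (rule trans_inv_image)
  then show "nf_less d \<mu> \<nu> \<Longrightarrow> nf_less d \<nu> \<kappa> \<Longrightarrow> nf_less d \<mu> \<kappa>"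
    unfolding nf_less_lenlex by (rule transD)
qed

lemma nf_less_linear: "nf_less d \<mu> \<nu> \<or> \<mu> = \<nu> \<or> nf_less d \<nu> \<mu>"
proof -
  have "total (lenlex {(a, b). a < (b::'a)})" by (intro total_lenlex) (auto simp: total_on_def)
  then have "letters \<mu> = letters \<nu> \<or> (letters \<mu>, letters \<nu>) \<in> lenlex {(a, b). a < b}
      \<or> (letters \<nu>, letters \<mu>) \<in> lenlex {(a, b). a < b}"
    by (auto simp: total_on_def)
  then show ?thesis
    using letters_inject[of \<mu> \<nu>] by (auto simp: nf_less_lenlex)
qed

lemma nf_less_asym: "nf_less d \<mu> \<nu> \<Longrightarrow> \<not> nf_less d \<nu> \<mu>"
  using nf_less_trans nf_less_irrefl by blast

lemma nf_less_Snoc_mono: "nf_less d \<mu> \<nu> \<Longrightarrow> nf_less d (Snoc \<mu> b) (Snoc \<nu> b)"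
  unfolding nf_less_def by (auto simp: nf_length_def intro: lexord_append_leftI lexord_sufI)

text \<open>The second premise supplies \<open>d c \<le> d b\<close>; \<open>c < b\<close> decides
  the lexicographic comparison when the degrees agree.\<close>

lemma nf_less_Snoc_Letter: "c < b \<Longrightarrow> nf_less d (Letter c) (Letter b) \<Longrightarrow> nf_less d (Snoc \<mu> c) (Snoc \<mu> b)"
  unfolding nf_less_def by (auto simp: nf_length_def intro: lexord_append_leftI)

lemma nf_less_Snoc: "nf_less d \<mu> (Snoc \<mu> b)"
  unfolding nf_less_def by auto

lemma nf_less_Letter_Snoc: "nf_less d (Letter b) (Snoc \<mu> b)"
  unfolding nf_less_def by auto

lemma nf_less_deg_le: "nf_less d \<mu> \<nu> \<Longrightarrow> nf_deg d \<mu> \<le> nf_deg d \<nu>"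
  unfolding nf_less_def by auto

text \<open>Since a letter has the least possible length, only its lexicographic rank matters among the
  monomials of its own degree.\<close>

lemma nf_less_LetterE:
  assumes "nf_less d \<kappa> (Letter b)"
  obtains "nf_deg d \<kappa> < d b" | c where "\<kappa> = Letter c" "c < b" "d c = d b"
proof (cases "nf_deg d \<kappa> < d b")
  case False
  then have "nf_length \<kappa> = 1"
    using assms nf_length_pos[of \<kappa>] by (auto simp: nf_less_def)
  then obtain c where "\<kappa> = Letter c" by (rule nf_length_1E)
  then show thesis using assms False that(2) by (auto simp: nf_less_def)
qed (use that in auto)

section \<open>Leading monomials, and linear maps checked on monomials\<close>

lemma finite_nf_greatest:
  assumes "finite K" "K \<noteq> {}"
  shows "\<exists>\<mu>\<in>K. \<forall>\<nu>\<in>K. \<nu> \<noteq> \<mu> \<longrightarrow> nf_less d \<nu> \<mu>"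
  using assms
proof (induction rule: finite_ne_induct)
  case (insert \<kappa> K)
  then obtain \<mu> where \<mu>: "\<mu> \<in> K" "\<forall>\<nu>\<in>K. \<nu> \<noteq> \<mu> \<longrightarrow> nf_less d \<nu> \<mu>" by blast
  show ?case
  proof (cases "nf_less d \<mu> \<kappa>")
    case True
    then show ?thesis using \<mu> by (intro bexI[of _ \<kappa>]) (auto intro: nf_less_trans)
  next
    case False
    then show ?thesis using \<mu> nf_less_linear[of d] by (intro bexI[of _ \<mu>]) auto
  qed
qed simp

lemma lead_eqI:
  assumes "\<mu> \<in> Poly_Mapping.keys f" "\<And>\<nu>. \<nu> \<in> Poly_Mapping.keys f \<Longrightarrow> \<nu> \<noteq> \<mu> \<Longrightarrow> nf_less d \<nu> \<mu>"
  shows "lead d f = \<mu>"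
  unfolding lead_def
proof (rule the_equality)
  fix \<nu>
  assume "\<nu> \<in> Poly_Mapping.keys f \<and> (\<forall>\<kappa>\<in>Poly_Mapping.keys f. \<kappa> \<noteq> \<nu> \<longrightarrow> nf_less d \<kappa> \<nu>)"
  then show "\<nu> = \<mu>" using assms(1) assms(2)[of \<nu>] nf_less_asym[of d \<mu> \<nu>] by auto
qed (use assms in auto)

lemma lead_greatest:
  assumes "f \<noteq> 0"
  shows "lead d f \<in> Poly_Mapping.keys f"
    and "\<nu> \<in> Poly_Mapping.keys f \<Longrightarrow> \<nu> \<noteq> lead d f \<Longrightarrow> nf_less d \<nu> (lead d f)"
proof -
  have "Poly_Mapping.keys f \<noteq> {}" using assms by simp
  then obtain \<mu> where "\<mu> \<in> Poly_Mapping.keys f"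
    "\<forall>\<nu>\<in>Poly_Mapping.keys f. \<nu> \<noteq> \<mu> \<longrightarrow> nf_less d \<nu> \<mu>"
    using finite_nf_greatest[OF finite_keys] by blast
  moreover from this have "lead d f = \<mu>" by (intro lead_eqI) auto
  ultimately show "lead d f \<in> Poly_Mapping.keys f"
    "\<nu> \<in> Poly_Mapping.keys f \<Longrightarrow> \<nu> \<noteq> lead d f \<Longrightarrow> nf_less d \<nu> (lead d f)" by auto
qed

lemma linear_in_subspace:
  assumes "Vector_Spaces.linear lb_scale lb_scale F" "lb.subspace U"
    and "\<And>\<mu>. \<mu> \<in> Poly_Mapping.keys f \<Longrightarrow> F (mon \<mu>) \<in> U"
  shows "F f \<in> U"
  unfolding linear_expand[OF assms(1), of f]
  by (rule lin_ext_in_subspace[OF lb.vector_space_axioms assms(2)]) (rule assms(3))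

lemma in_subspace:
  assumes "lb.subspace U" "\<And>\<mu>. \<mu> \<in> Poly_Mapping.keys f \<Longrightarrow> mon \<mu> \<in> U"
  shows "f \<in> U"
  using linear_in_subspace[where F = "\<lambda>x. x", OF _ assms] by (simp add: lb.linear_ident)

lemma linear_span_subset:
  assumes "Vector_Spaces.linear lb_scale lb_scale F" "lb.subspace U"
    and "\<And>h. h \<in> A \<Longrightarrow> F h \<in> U" "f \<in> lb.span A"
  shows "F f \<in> U"
proof -
  interpret F: Vector_Spaces.linear lb_scale lb_scale F by fact
  show ?thesis
    using assms(4) by (induction rule: lb.span_induct_alt)
      (simp_all add: F.add F.scale F.zero assms(2,3) lb.subspace_add lb.subspace_scale lb.subspace_0)
qed

lemma keys_subset_subspace: "lb.subspace {f. Poly_Mapping.keys f \<subseteq> K}"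
proof (rule lb.subspaceI)
  show "x + y \<in> {f. Poly_Mapping.keys f \<subseteq> K}"
    if "x \<in> {f. Poly_Mapping.keys f \<subseteq> K}" "y \<in> {f. Poly_Mapping.keys f \<subseteq> K}" for x y
    using that Poly_Mapping.keys_add[of x y] by auto
qed (auto simp: in_keys_iff)

lemma keys_mon [simp]: "Poly_Mapping.keys (mon \<mu> :: ('x, 'k::field) lb) = {\<mu>}"
  by (simp add: mon_def)

lemma lookup_mon: "Poly_Mapping.lookup (mon \<mu>) \<nu> = (if \<mu> = \<nu> then 1 else 0)"
  by (simp add: mon_def lookup_single when_def)

text \<open>Both terms of the Leibniz expansion carry the letters of the original product, so the
  algebra is graded by degree. The second term moves a letter to the left factor, hence \<mu>
  varies.\<close>

lemma keys_nf_mult: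
  "Poly_Mapping.keys (nf_mult p \<mu> \<nu> :: ('x, 'k::field) lb) \<subseteq> {\<kappa>. nf_deg d \<kappa> = nf_deg d \<mu> + nf_deg d \<nu>}"
proof (induction \<nu> arbitrary: \<mu>)
  case (Letter b)
  then show ?case by simp
next
  case (Snoc \<nu> b)
  let ?K = "{\<kappa>. nf_deg d \<kappa> = nf_deg d \<mu> + nf_deg d (Snoc \<nu> b)}"
  let ?U = "{f :: ('x, 'k) lb. Poly_Mapping.keys f \<subseteq> ?K}"
  have "lin_ext lb_scale (\<lambda>\<kappa>. mon (Snoc \<kappa> b)) (nf_mult p \<mu> \<nu>) \<in> ?U"
    by (rule lin_ext_in_subspace[OF lb.vector_space_axioms keys_subset_subspace])
       (use Snoc[of \<mu>] in auto)
  moreover have "nf_mult p (Snoc \<mu> b) \<nu> \<in> ?U"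
    using Snoc[of "Snoc \<mu> b"] by auto
  ultimately have "nf_mult p \<mu> (Snoc \<nu> b) \<in> ?U"
    unfolding nf_mult.simps
    by (intro lb.subspace_diff[OF keys_subset_subspace] lb.subspace_scale[OF keys_subset_subspace])
  then show ?case by blast
qed


section \<open>Normal polynomials with their leading monomials\<close>

context
  fixes p :: "'x::wellorder \<Rightarrow> bit" and d :: "'x \<Rightarrow> nat"
begin

interpretation lbs: leibniz_superalgebra lb_scale "lb_mult p" "lb_part p"
  by (rule lb_leibniz_superalgebra)

private abbreviation (input) less (infix \<open>\<prec>\<close> 50) where "\<mu> \<prec> \<nu> \<equiv> nf_less d \<mu> \<nu>"

private abbreviation (input) mul (infixl \<open>\<cdot>\<close> 70) where "f \<cdot> g \<equiv> lb_mult p f g"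

section \<open>Elements with a prescribed leading monomial\<close>

definition below :: "'x nf \<Rightarrow> ('x, 'k::field) lb set" where
  "below \<mu> = {f. Poly_Mapping.keys f \<subseteq> {\<nu>. \<nu> \<prec> \<mu>}}"

text \<open>Being monic with leading monomial \<mu> is phrased as membership in a subspace, which
  passes through linear maps and differences and avoids the definite description in
  \<open>lead\<close>.\<close>

definition has_lead :: "'x nf \<Rightarrow> ('x, 'k::field) lb \<Rightarrow> bool" where
  "has_lead \<mu> f \<longleftrightarrow> f - mon \<mu> \<in> below \<mu>"

lemma below_subspace: "lb.subspace (below \<mu>)"
  unfolding below_def by (rule keys_subset_subspace)

lemma mon_below [simp]: "mon \<nu> \<in> below \<mu> \<longleftrightarrow> \<nu> \<prec> \<mu>"
  by (simp add: below_def)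

lemma belowD: "f \<in> below \<mu> \<Longrightarrow> \<nu> \<in> Poly_Mapping.keys f \<Longrightarrow> \<nu> \<prec> \<mu>"
  by (auto simp: below_def)

lemma has_lead_lookup:
  assumes "has_lead \<mu> f"
  shows "Poly_Mapping.lookup f \<mu> = 1" and "\<nu> \<in> Poly_Mapping.keys f \<Longrightarrow> \<nu> \<noteq> \<mu> \<Longrightarrow> \<nu> \<prec> \<mu>"
proof -
  have "\<mu> \<notin> Poly_Mapping.keys (f - mon \<mu>)"
    using assms belowD nf_less_irrefl unfolding has_lead_def by blast
  then show "Poly_Mapping.lookup f \<mu> = 1"
    by (simp add: in_keys_iff lookup_minus lookup_mon)
  show "\<nu> \<prec> \<mu>" if "\<nu> \<in> Poly_Mapping.keys f" "\<nu> \<noteq> \<mu>"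
    using assms belowD[of "f - mon \<mu>" \<mu> \<nu>] that unfolding has_lead_def
    by (simp add: in_keys_iff lookup_minus lookup_mon)
qed

lemma has_lead_lead: "has_lead \<mu> f \<Longrightarrow> lead d f = \<mu>"
  by (rule lead_eqI) (simp_all add: in_keys_iff has_lead_lookup)

lemma has_lead_nonzero: "has_lead \<mu> f \<Longrightarrow> f \<noteq> 0"
  using has_lead_lookup(1) by fastforce

lemma has_lead_monic: "has_lead \<mu> f \<Longrightarrow> monic d f"
  by (simp add: monic_def has_lead_lead has_lead_lookup has_lead_nonzero)

lemma monic_has_lead: "monic d f \<Longrightarrow> has_lead (lead d f) f"
  unfolding monic_def has_lead_def below_def
  using lead_greatest(2)[of f _ d]
  by (auto simp: in_keys_iff lookup_minus lookup_mon split: if_splits)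

lemma has_lead_diff_below:
  assumes "has_lead \<mu> f" "has_lead \<mu> g"
  shows "f - g \<in> below \<mu>"
  using lb.subspace_diff[OF below_subspace, of "f - mon \<mu>" \<mu> "g - mon \<mu>"] assms
  by (simp add: has_lead_def)

lemma has_lead_normalize:
  assumes "f \<noteq> 0"
  shows "has_lead (lead d f) (lb_scale (inverse (Poly_Mapping.lookup f (lead d f))) f)"
  using lead_greatest[OF assms, where d = d] unfolding has_lead_def below_def
  by (auto simp: in_keys_iff lookup_minus lookup_mon split: if_splits)

lemma has_lead_mul_gen:
  assumes "has_lead \<mu> f"
  shows "has_lead (Snoc \<mu> b) (f \<cdot> gen b)"
proof -
  have "(f - mon \<mu>) \<cdot> gen b \<in> below (Snoc \<mu> b)"
    by (rule linear_in_subspace[OF lb_mult_linear_left below_subspace])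
       (use assms in \<open>auto simp: has_lead_def mono_Snoc[symmetric] intro: nf_less_Snoc_mono dest: belowD\<close>)
  then show ?thesis
    by (simp add: has_lead_def lb_mult_simps mono_Snoc[of \<mu> b p])
qed

text \<open>A lower monomial of \<open>s\<close> either has lower degree, and degree is additive, or
  is a smaller letter of the same degree, which is simply appended to \<nu>.\<close>

lemma has_lead_mon_mul:
  assumes "has_lead (Letter b) s"
  shows "has_lead (Snoc \<nu> b) (mon \<nu> \<cdot> s)"
proof -
  have "mon \<nu> \<cdot> (s - mon (Letter b)) \<in> below (Snoc \<nu> b)"
  proof (rule linear_in_subspace[OF lb_mult_linear_right below_subspace])
    fix \<kappa> assume "\<kappa> \<in> Poly_Mapping.keys (s - mon (Letter b))"
    then have "\<kappa> \<prec> Letter b" using assms belowD by (auto simp: has_lead_def)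
    then show "mon \<nu> \<cdot> mon \<kappa> \<in> below (Snoc \<nu> b)"
    proof (cases rule: nf_less_LetterE)
      case 1
      then show ?thesis
        using keys_nf_mult[of p \<nu> \<kappa> d] by (auto simp: lb_mult_mono below_def nf_less_def)
    next
      case (2 c)
      then show ?thesis
        using \<open>\<kappa> \<prec> Letter b\<close> by (simp add: lb_mult_mono nf_less_Snoc_Letter)
    qed
  qed
  then show ?thesis
    by (simp add: has_lead_def lb_mult_simps lb_mult_mono)
qed

section \<open>Inductive description of normal polynomials\<close>

text \<open>\<open>normal S h \<mu>\<close>: \<open>h\<close> is a normal \<open>S\<close>-polynomial and, when \<open>S\<close> is monic, \<open>\<mu>\<close> is its
  leading monomial.\<close>

inductive normal :: "('x, 'k::field) lb set \<Rightarrow> ('x, 'k) lb \<Rightarrow> 'x nf \<Rightarrow> bool" for S where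
  base: "s \<in> S \<Longrightarrow> normal S s (lead d s)"
| left: "s \<in> S \<Longrightarrow> lead d s = Letter b \<Longrightarrow> normal S (mon \<nu> \<cdot> s) (Snoc \<nu> b)"
| right: "normal S h \<mu> \<Longrightarrow> normal S (h \<cdot> gen b) (Snoc \<mu> b)"

lemma normal_mono: "normal S h \<mu> \<Longrightarrow> S \<subseteq> T \<Longrightarrow> normal T h \<mu>"
  by (induction rule: normal.induct) (auto intro: normal.intros)

text \<open>A derivation has a single leaf in \<open>S\<close>, which attributes the normal
  polynomial to one element.\<close>

lemma normal_singleton: "normal S h \<mu> \<Longrightarrow> \<exists>s\<in>S. normal {s} h \<mu>"
  by (induction rule: normal.induct) (auto intro: normal.intros)

text \<open>The rules \<open>left\<close> and \<open>right\<close> lengthen the monomial and so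
  raise it; only \<open>s\<close> itself attains \<open>lead d s\<close>.\<close>

lemma normal_singleton_cases: "normal {s} h \<mu> \<Longrightarrow> h = s \<and> \<mu> = lead d s \<or> lead d s \<prec> \<mu>"
  by (induction rule: normal.induct) (auto intro: nf_less_Letter_Snoc nf_less_Snoc nf_less_trans)

lemma normal_has_lead: "normal S h \<mu> \<Longrightarrow> \<forall>s\<in>S. monic d s \<Longrightarrow> has_lead \<mu> h"
proof (induction rule: normal.induct)
  case (left s b \<nu>)
  then show ?case using monic_has_lead[of s] by (auto intro: has_lead_mon_mul)
qed (auto intro: monic_has_lead has_lead_mul_gen)

lemma homogeneous_mul: "homogeneous p f \<Longrightarrow> homogeneous p g \<Longrightarrow> homogeneous p (f \<cdot> g)"
  unfolding homogeneous_def using lb_mult_part by blast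

lemma homogeneous_mon: "homogeneous p (mon \<mu>)"
  unfolding homogeneous_def using mono_part by blast

lemma normal_homogeneous:
  "normal S h \<mu> \<Longrightarrow> \<forall>s\<in>S. homogeneous p s \<Longrightarrow> homogeneous p h"
  by (induction rule: normal.induct) (auto intro: homogeneous_mul homogeneous_mon simp: gen_def)

lemma normal_in_ideal:
  "normal S h \<mu> \<Longrightarrow> lbs.ideal J \<Longrightarrow> S \<subseteq> J \<Longrightarrow> h \<in> J"
  by (induction rule: normal.induct) (auto simp: lbs.ideal_def)

lemma normal_left_normed:
  "normal S h \<mu> \<Longrightarrow> \<exists>\<nu>. normal S (left_normed p h (map gen as)) \<nu>"
proof (induction as rule: rev_induct)
  case (snoc a as)
  then show ?case by (auto simp: left_normed_def intro: normal.right)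
qed (auto simp: left_normed_def)

lemma left_normed_gens: "left_normed p (gen a) (map gen as) = mon (foldl Snoc (Letter a) as)"
  by (induction as rule: rev_induct) (auto simp: left_normed_def gen_def[of a] mono_Snoc[of _ _ p])

text \<open>In the second kind the word in front of \<open>s\<close> is nonempty and its left-normed
  product is a basis monomial, the \<nu> of \<open>left\<close>; the word behind \<open>s\<close> is
  a chain of \<open>right\<close> steps.\<close>

lemma normal_polys_iff: "h \<in> normal_polys p d S \<longleftrightarrow> (\<exists>\<mu>. normal S h \<mu>)"
proof
  assume "h \<in> normal_polys p d S"
  then obtain s where s: "s \<in> S" "h \<in> normal_polys_of p d s" by (auto simp: normal_polys_def)
  then consider as where "h = left_normed p s (map gen as)"
    | a as bs where "h = left_normed p (gen a) (map gen as @ s # map gen bs)" "nf_length (lead d s) = 1"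
    by (auto simp: normal_polys_of_def)
  then show "\<exists>\<mu>. normal S h \<mu>"
  proof cases
    case 1
    then show ?thesis using normal_left_normed[OF normal.base[OF s(1)]] by simp
  next
    case (2 a as bs)
    obtain b where b: "lead d s = Letter b" using 2(2) by (rule nf_length_1E)
    have "h = left_normed p (left_normed p (gen a) (map gen as) \<cdot> s) (map gen bs)"
      by (simp add: 2 left_normed_def)
    then show ?thesis
      using normal_left_normed[OF normal.left[OF s(1) b]] by (simp add: left_normed_gens)
  qed
next
  assume "\<exists>\<mu>. normal S h \<mu>"
  then obtain \<mu> where "normal S h \<mu>" ..
  then show "h \<in> normal_polys p d S"
  proof (induction rule: normal.induct)
    case (base s)
    then show ?case unfolding normal_polys_def normal_polys_of_def
      by (auto intro!: bexI[of _ s] exI[of _ "[]"] simp: left_normed_def)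
  next
    case (left s b \<nu>)
    have "mon \<nu> \<cdot> s = left_normed p (gen (hd (letters \<nu>))) (map gen (tl (letters \<nu>)) @ s # map gen [])"
      by (subst mono_eq_left_normed[of \<nu> p]) (simp add: left_normed_def)
    moreover have "nf_length (lead d s) = 1" by (simp add: left)
    ultimately have "mon \<nu> \<cdot> s \<in> normal_polys_of p d s"
      unfolding normal_polys_of_def by blast
    then show ?case using left by (auto simp: normal_polys_def)
  next
    case (right h \<mu> b)
    then obtain s where s: "s \<in> S" "h \<in> normal_polys_of p d s" by (auto simp: normal_polys_def)
    have snoc: "left_normed p f fs \<cdot> gen b = left_normed p f (fs @ [gen b])" for f fs
      by (simp add: left_normed_def)
    have "h \<cdot> gen b \<in> normal_polys_of p d s"
      using s(2) unfolding normal_polys_of_def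
    proof (elim UnE CollectE exE conjE)
      fix as assume "h = left_normed p s (map gen as)"
      then have "h \<cdot> gen b = left_normed p s (map gen (as @ [b]))" by (simp add: snoc)
      then show "h \<cdot> gen b \<in> {left_normed p s (map gen as) |as. True} \<union>
        {left_normed p (gen a) (map gen as @ s # map gen bs) |a as bs. nf_length (lead d s) = 1}"
        by blast
    next
      fix a as bs assume "h = left_normed p (gen a) (map gen as @ s # map gen bs)"
        and l: "nf_length (lead d s) = 1"
      then have "h \<cdot> gen b = left_normed p (gen a) (map gen as @ s # map gen (bs @ [b]))"
        by (simp add: snoc)
      then show "h \<cdot> gen b \<in> {left_normed p s (map gen as) |as. True} \<union>
        {left_normed p (gen a) (map gen as @ s # map gen bs) |a as bs. nf_length (lead d s) = 1}"
        using l by blast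
    qed
    then show ?case using s by (auto simp: normal_polys_def)
  qed
qed

section \<open>Irreducibility, triviality and spans in terms of \<open>normal\<close>\<close>

lemma Irr_iff:
  assumes "\<forall>s\<in>S. monic d s"
  shows "\<mu> \<in> Irr p d S \<longleftrightarrow> \<not> (\<exists>h. normal S h \<mu>)"
proof -
  have "lead d h = \<nu>" if "normal S h \<nu>" for h \<nu>
    using has_lead_lead[OF normal_has_lead[OF that assms]] .
  then show ?thesis unfolding Irr_def Ball_def normal_polys_iff by auto
qed

text \<open>The predicate bounds the leading monomials, so both kinds of triviality and the full
  span are instances of one notion.\<close>

definition normal_span :: "('x, 'k::field) lb set \<Rightarrow> ('x nf \<Rightarrow> bool) \<Rightarrow> ('x, 'k) lb set" where
  "normal_span S P = lb.span {h. \<exists>\<mu>. P \<mu> \<and> normal S h \<mu>}"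

lemma normal_span_subspace: "lb.subspace (normal_span S P)"
  unfolding normal_span_def by (rule lb.subspace_span)

lemma normal_span_base: "normal S h \<mu> \<Longrightarrow> P \<mu> \<Longrightarrow> h \<in> normal_span S P"
  unfolding normal_span_def by (rule lb.span_base) auto

lemma normal_span_mono: "f \<in> normal_span S P \<Longrightarrow> (\<And>\<mu>. P \<mu> \<Longrightarrow> Q \<mu>) \<Longrightarrow> f \<in> normal_span S Q"
  unfolding normal_span_def by (erule subsetD[OF lb.span_mono, rotated]) blast

lemma linear_normal_span:
  assumes "Vector_Spaces.linear lb_scale lb_scale F" "lb.subspace U" "f \<in> normal_span S P"
    and "\<And>h \<mu>. P \<mu> \<Longrightarrow> normal S h \<mu> \<Longrightarrow> F h \<in> U"
  shows "F f \<in> U"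
  by (rule linear_span_subset[OF assms(1,2) _ assms(3)[unfolded normal_span_def]])
     (use assms(4) in blast)

lemma normal_span_mul_gen:
  assumes "f \<in> normal_span S P" "\<And>\<mu>. P \<mu> \<Longrightarrow> Q (Snoc \<mu> b)"
  shows "f \<cdot> gen b \<in> normal_span S Q"
  by (rule linear_normal_span[OF lb_mult_linear_left normal_span_subspace assms(1)])
     (auto intro: normal_span_base normal.right assms(2))

lemma trivial_below_iff:
  assumes "\<forall>s\<in>S. monic d s"
  shows "trivial_below p d S \<mu> f \<longleftrightarrow> f \<in> normal_span S (\<lambda>\<nu>. \<nu> \<prec> \<mu>)"
proof -
  have "{h \<in> normal_polys p d S. lead d h \<prec> \<mu>} = {h. \<exists>\<nu>. \<nu> \<prec> \<mu> \<and> normal S h \<nu>}"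
    using has_lead_lead[OF normal_has_lead[OF _ assms]] by (fastforce simp: normal_polys_iff)
  then show ?thesis by (simp add: trivial_below_def normal_span_def)
qed

lemma trivial_upto_deg_iff:
  assumes "\<forall>s\<in>S. monic d s"
  shows "trivial_upto_deg p d S n f \<longleftrightarrow> f \<in> normal_span S (\<lambda>\<nu>. nf_deg d \<nu> \<le> n)"
proof -
  have "{h \<in> normal_polys p d S. nf_deg d (lead d h) \<le> n} = {h. \<exists>\<nu>. nf_deg d \<nu> \<le> n \<and> normal S h \<nu>}"
    using has_lead_lead[OF normal_has_lead[OF _ assms]] by (fastforce simp: normal_polys_iff)
  then show ?thesis by (simp add: trivial_upto_deg_def normal_span_def)
qed

text \<open>The Leibniz identity replaces the factor \<open>Snoc \<kappa> b\<close> by the factors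
  \<kappa> and \<open>b\<close> in both orders; one of them multiplies \<open>h\<close> by
  \<open>b\<close> first, so \<open>h\<close> and \<nu> vary in the induction.\<close>

lemma normal_mul_mon:
  "normal S h \<nu> \<Longrightarrow> h \<cdot> mon \<kappa> \<in> normal_span S (\<lambda>\<mu>. nf_deg d \<mu> = nf_deg d \<nu> + nf_deg d \<kappa>)"
proof (induction \<kappa> arbitrary: h \<nu>)
  case (Letter b)
  then show ?case
    by (auto intro!: normal_span_base normal.right simp: gen_def[symmetric])
next
  case (Snoc \<kappa> b)
  have "h \<cdot> mon \<kappa> \<cdot> gen b \<in> normal_span S (\<lambda>\<mu>. nf_deg d \<mu> = nf_deg d \<nu> + nf_deg d (Snoc \<kappa> b))"
    by (rule normal_span_mul_gen[OF Snoc.IH[OF Snoc.prems]]) simp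
  moreover have "h \<cdot> gen b \<cdot> mon \<kappa> \<in> normal_span S (\<lambda>\<mu>. nf_deg d \<mu> = nf_deg d \<nu> + nf_deg d (Snoc \<kappa> b))"
    by (rule normal_span_mono[OF Snoc.IH[OF normal.right[OF Snoc.prems]]]) simp
  ultimately show ?case
    unfolding lb_mult_mono_Snoc
    by (intro lb.subspace_diff lb.subspace_scale normal_span_subspace)
qed


section \<open>The ideal generated by a Groebner--Shirshov basis\<close>

lemma normal_span_mul_right:
  assumes "f \<in> normal_span S (\<lambda>_. True)"
  shows "f \<cdot> g \<in> normal_span S (\<lambda>_. True)"
proof (rule linear_in_subspace[OF lb_mult_linear_right normal_span_subspace])
  fix \<kappa>
  show "f \<cdot> mon \<kappa> \<in> normal_span S (\<lambda>_. True)"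
    by (rule linear_normal_span[OF lb_mult_linear_left normal_span_subspace assms])
       (blast intro: normal_span_mono normal_mul_mon)
qed

text \<open>For a member of \<open>S\<close> this is the assumption \<open>long\<close> or the rule
  \<open>left\<close>, according to the length of its leading monomial. The Leibniz identity carries
  it through the other rules, leaving right multiplications, which the span absorbs.\<close>

lemma mon_mul_normal:
  assumes hom: "\<forall>s\<in>S. homogeneous p s"
    and long: "\<And>s \<kappa>. s \<in> S \<Longrightarrow> nf_length (lead d s) > 1 \<Longrightarrow> mon \<kappa> \<cdot> s \<in> normal_span S (\<lambda>_. True)"
  shows "normal S h \<mu> \<Longrightarrow> mon \<kappa> \<cdot> h \<in> normal_span S (\<lambda>_. True)"
proof (induction arbitrary: \<kappa> rule: normal.induct)
  case (base s)
  show ?case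
  proof (cases "nf_length (lead d s) > 1")
    case True
    then show ?thesis using long base by blast
  next
    case False
    then have "nf_length (lead d s) = 1" using nf_length_pos[of "lead d s"] by linarith
    then obtain b where "lead d s = Letter b" by (rule nf_length_1E)
    then show ?thesis using base by (blast intro: normal_span_base normal.left)
  qed
next
  case (left s b \<nu>)
  have mon_s: "mon \<tau> \<cdot> s \<in> normal_span S (\<lambda>_. True)" for \<tau>
    using left by (blast intro: normal_span_base normal.left)
  obtain i where i: "s \<in> lb_part p i" using hom left by (auto simp: homogeneous_def)
  \<comment> \<open>The product of \<kappa> and \<nu> is a combination of monomials, each giving a
    normal polynomial with \<open>s\<close>.\<close>
  have left_part: "mon \<kappa> \<cdot> mon \<nu> \<cdot> s \<in> normal_span S (\<lambda>_. True)"
    by (rule linear_in_subspace[OF lb_mult_linear_left normal_span_subspace]) (rule mon_s)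
  show ?case
    unfolding lb_leibniz[OF mono_part i]
    by (intro lb.subspace_diff lb.subspace_scale normal_span_subspace left_part
        normal_span_mul_right[OF mon_s])
next
  case (right h \<mu> b)
  obtain i where i: "h \<in> lb_part p i"
    using normal_homogeneous[OF right(1) hom] by (auto simp: homogeneous_def)
  have g: "gen b \<in> lb_part p (p b)" using mono_part[of "Letter b" p] by (simp add: gen_def)
  \<comment> \<open>The product of \<kappa> and \<open>gen b\<close> is again a monomial, so the
    induction hypothesis serves both terms.\<close>
  show ?case
    unfolding lb_leibniz[OF i g] mono_Snoc[symmetric]
    by (intro lb.subspace_diff lb.subspace_scale normal_span_subspace normal_span_mul_right right.IH)
qed

text \<open>The span is a right ideal by the Leibniz identity and a left ideal by the condition on
  left multiplications in \<open>gs_basis\<close>; every ideal containing \<open>S\<close> contains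
  it.\<close>

lemma ideal_generated_eq_normal_span:
  fixes S :: "('x, 'k::field) lb set"
  assumes gs: "gs_basis p d S"
  shows "lbs.ideal_generated S = normal_span S (\<lambda>_. True)"
proof -
  have monic: "\<forall>s\<in>S. monic d s" and hom: "\<forall>s\<in>S. homogeneous p s"
    using gs by (auto simp: gs_basis_def)
  \<comment> \<open>The basis condition speaks only of nonzero products; a zero product lies in
    every span.\<close>
  have long: "mon \<kappa> \<cdot> s \<in> normal_span S (\<lambda>_. True)" if "s \<in> S" "nf_length (lead d s) > 1" for s \<kappa>
  proof (cases "mon \<kappa> \<cdot> s = 0")
    case True
    then show ?thesis using lb.subspace_0[OF normal_span_subspace] by metis
  next
    case False
    then have "trivial_upto_deg p d S (nf_deg d \<kappa> + nf_deg d (lead d s)) (mon \<kappa> \<cdot> s)"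
      using gs that unfolding gs_basis_def by blast
    then show ?thesis
      unfolding trivial_upto_deg_iff[OF monic] by (rule normal_span_mono) simp
  qed
  have left: "g \<cdot> f \<in> normal_span S (\<lambda>_. True)" if f: "f \<in> normal_span S (\<lambda>_. True)" for f g
  proof (rule linear_in_subspace[OF lb_mult_linear_left normal_span_subspace])
    fix \<kappa>
    show "mon \<kappa> \<cdot> f \<in> normal_span S (\<lambda>_. True)"
      by (rule linear_normal_span[OF lb_mult_linear_right normal_span_subspace f])
         (rule mon_mul_normal[OF hom long])
  qed
  have ideal: "lbs.ideal (normal_span S (\<lambda>_. True))"
    using left by (auto simp: lbs.ideal_def normal_span_subspace normal_span_mul_right)
  show ?thesis
    unfolding lbs.ideal_generated_def
  proof (rule hull_unique)
    show "S \<subseteq> normal_span S (\<lambda>_. True)" by (auto intro: normal_span_base normal.base)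
    fix J assume J: "S \<subseteq> J" "lbs.ideal J"
    show "normal_span S (\<lambda>_. True) \<subseteq> J"
      unfolding normal_span_def
      by (rule lb.span_minimal) (use J normal_in_ideal[OF _ J(2,1)] in \<open>auto simp: lbs.ideal_def\<close>)
  qed (rule ideal)
qed

section \<open>Reduced sets: normal polynomials with equal leading monomials\<close>

text \<open>For a reduced set no inclusion composition exists, so the only overlap of two normal
  polynomials left to resolve is \<open>u \<cdot> b\<close> against \<open>\<nu> \<cdot> s\<close>, where \<open>\<nu>\<close> is the leading monomial of \<open>u\<close>
  and \<open>b\<close> that of \<open>s\<close>. It is resolved by \<open>u b - \<nu> s = u (b - s) + (u - \<nu>) s\<close>.\<close>

lemma normal_left_right_diff:
  assumes monic: "\<forall>s\<in>S. monic d s" and u: "normal S u \<nu>" and s: "s \<in> S" "lead d s = Letter b"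
  shows "u \<cdot> gen b - mon \<nu> \<cdot> s \<in> normal_span S (\<lambda>\<kappa>. \<kappa> \<prec> Snoc \<nu> b)"
proof -
  let ?V = "normal_span S (\<lambda>\<kappa>. \<kappa> \<prec> Snoc \<nu> b)"
  have s_lead: "s - gen b \<in> below (Letter b)"
    using monic_has_lead[of s] monic s by (simp add: has_lead_def gen_def)
  have "u \<cdot> (s - gen b) \<in> ?V"
  proof (rule linear_in_subspace[OF lb_mult_linear_right normal_span_subspace])
    fix \<kappa> assume "\<kappa> \<in> Poly_Mapping.keys (s - gen b)"
    then have \<kappa>: "\<kappa> \<prec> Letter b" using s_lead belowD by blast
    then show "u \<cdot> mon \<kappa> \<in> ?V"
    proof (cases rule: nf_less_LetterE)
      case 1
      then show ?thesis
        by (intro normal_span_mono[OF normal_mul_mon[OF u]]) (auto simp: nf_less_def)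
    next
      case (2 c)
      then have "Snoc \<nu> c \<prec> Snoc \<nu> b" using \<kappa> nf_less_Snoc_Letter by blast
      then show ?thesis
        using normal.right[OF u, of c] 2 by (auto intro: normal_span_base simp: gen_def)
    qed
  qed
  moreover have "(u - mon \<nu>) \<cdot> s \<in> ?V"
  proof (rule linear_in_subspace[OF lb_mult_linear_left normal_span_subspace])
    fix \<kappa> assume "\<kappa> \<in> Poly_Mapping.keys (u - mon \<nu>)"
    then have "\<kappa> \<prec> \<nu>"
      using normal_has_lead[OF u monic] belowD by (auto simp: has_lead_def)
    then show "mon \<kappa> \<cdot> s \<in> ?V"
      by (intro normal_span_base[OF normal.left[OF s]] nf_less_Snoc_mono)
  qed
  ultimately have "(u - mon \<nu>) \<cdot> s - u \<cdot> (s - gen b) \<in> ?V"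
    by (intro lb.subspace_diff normal_span_subspace)
  then show ?thesis by (simp add: lb_mult_simps algebra_simps)
qed

text \<open>The leading monomial of \<open>s\<close> lies in its support, so reducedness denies it
  to normal polynomials of other elements; among those built from \<open>s\<close>, only
  \<open>s\<close> has it.\<close>

lemma reduced_normal_eq:
  assumes monic: "\<forall>s\<in>S. monic d s" and red: "reduced p d S"
    and s: "s \<in> S" and h: "normal S h (lead d s)"
  shows "h = s"
proof -
  obtain t where t: "t \<in> S" "normal {t} h (lead d s)" using normal_singleton[OF h] by blast
  have "lead d s \<in> Poly_Mapping.keys s"
    using monic s lead_greatest(1) by (auto simp: monic_def)
  then have "lead d s \<in> Irr p d (S - {s})" using red s by (auto simp: reduced_def)
  then have "\<not> normal (S - {s}) h (lead d s)"
    using monic Irr_iff[of "S - {s}" "lead d s"] by auto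
  then have "t = s" using t normal_mono[of "{t}" h "lead d s" "S - {s}"] by blast
  then show ?thesis using t normal_singleton_cases by fastforce
qed

text \<open>The last rules of both derivations are compared: a member of \<open>S\<close> has no
  rival, two \<open>left\<close> steps share their element because they share the letter
  \<open>b\<close>, mixed steps are the overlap resolved above, and two \<open>right\<close> steps
  reduce to the prefix.\<close>

lemma reduced_normal_diff:
  assumes monic: "\<forall>s\<in>S. monic d s" and red: "reduced p d S"
  shows "normal S g \<mu> \<Longrightarrow> normal S h \<mu> \<Longrightarrow> g - h \<in> normal_span S (\<lambda>\<nu>. \<nu> \<prec> \<mu>)"
proof (induction \<mu> arbitrary: g h)
  case (Letter b)
  have "g = h"
    using Letter.prems(1)
  proof cases
    case base
    then show ?thesis using reduced_normal_eq[OF monic red, of g h] Letter.prems by simp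
  qed
  then show ?case using lb.subspace_0[OF normal_span_subspace] by simp
next
  case (Snoc \<mu> b)
  let ?V = "normal_span S (\<lambda>\<nu>. \<nu> \<prec> Snoc \<mu> b)"
  have zero: "0 \<in> ?V" by (rule lb.subspace_0[OF normal_span_subspace])
  have base_case: "g - h \<in> ?V"
    if "normal S g (Snoc \<mu> b)" "normal S h (Snoc \<mu> b)" "g \<in> S \<and> Snoc \<mu> b = lead d g \<or> h \<in> S \<and> Snoc \<mu> b = lead d h"
    for g h
    using that(3)
  proof
    assume "g \<in> S \<and> Snoc \<mu> b = lead d g"
    then have "h = g" using reduced_normal_eq[OF monic red, of g h] that(2) by simp
    then show ?thesis using zero by simp
  next
    assume "h \<in> S \<and> Snoc \<mu> b = lead d h"
    then have "g = h" using reduced_normal_eq[OF monic red, of h g] that(1) by simp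
    then show ?thesis using zero by simp
  qed
  from Snoc.prems(1) show ?case
  proof cases
    case base
    then show ?thesis using base_case Snoc.prems by blast
  next
    case g: (left s)
    from Snoc.prems(2) show ?thesis
    proof cases
      case base
      then show ?thesis using base_case Snoc.prems by blast
    next
      case (left t)
      then have "t = s" using reduced_normal_eq[OF monic red, of s t] g normal.base[of t S] by simp
      then show ?thesis using zero g left by simp
    next
      case (right u)
      then show ?thesis
        using lb.subspace_neg[OF normal_span_subspace normal_left_right_diff[OF monic right(2) g(2,3)]]
        by (simp add: g)
    qed
  next
    case g: (right u)
    from Snoc.prems(2) show ?thesis
    proof cases
      case base
      then show ?thesis using base_case Snoc.prems by blast
    next
      case (left t)
      then show ?thesis using normal_left_right_diff[OF monic g(2) left(2,3)] by (simp add: g)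
    next
      case (right v)
      have "(u - v) \<cdot> gen b \<in> ?V"
        by (rule normal_span_mul_gen[OF Snoc.IH[OF g(2) right(2)]]) (rule nf_less_Snoc_mono)
      then show ?thesis by (simp add: g right lb_mult_simps)
    qed
  qed
qed

text \<open>A combination has finitely many terms, and the greatest of their monomials is the bound;
  \<open>f = 0\<close> covers the empty combination.\<close>

lemma normal_span_less_cases:
  assumes "f \<in> normal_span S P"
  shows "f = 0 \<or> (\<exists>\<mu>. P \<mu> \<and> f \<in> normal_span S (\<lambda>\<nu>. \<nu> = \<mu> \<or> \<nu> \<prec> \<mu>))"
  using assms unfolding normal_span_def[of S P]
proof (induction rule: lb.span_induct_alt)
  case (step c h f)
  let ?V = "\<lambda>\<mu>. normal_span S (\<lambda>\<nu>. \<nu> = \<mu> \<or> \<nu> \<prec> \<mu>)"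
  from step(1) obtain \<kappa> where \<kappa>: "P \<kappa>" "normal S h \<kappa>" by blast
  then have h: "lb_scale c h \<in> ?V \<kappa>"
    by (intro lb.subspace_scale normal_span_subspace normal_span_base[of S h \<kappa>]) auto
  from step(2) show ?case
  proof (elim disjE exE conjE)
    assume "f = 0"
    then show ?thesis using \<kappa> h by auto
  next
    fix \<mu> assume \<mu>: "P \<mu>" "f \<in> ?V \<mu>"
    define \<tau> where "\<tau> = (if \<mu> \<prec> \<kappa> then \<kappa> else \<mu>)"
    have "\<kappa> = \<tau> \<or> \<kappa> \<prec> \<tau>" "\<mu> = \<tau> \<or> \<mu> \<prec> \<tau>"
      using nf_less_linear[of d \<mu> \<kappa>] by (auto simp: \<tau>_def)
    then have "lb_scale c h \<in> ?V \<tau>" "f \<in> ?V \<tau>"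
      using normal_span_mono[OF h, of "\<lambda>\<nu>. \<nu> = \<tau> \<or> \<nu> \<prec> \<tau>"]
        normal_span_mono[OF \<mu>(2), of "\<lambda>\<nu>. \<nu> = \<tau> \<or> \<nu> \<prec> \<tau>"] nf_less_trans by blast+
    then have "lb_scale c h + f \<in> ?V \<tau>"
      by (intro lb.subspace_add normal_span_subspace)
    moreover have "P \<tau>" using \<kappa> \<mu> by (simp add: \<tau>_def)
    ultimately show ?thesis by blast
  qed
qed simp

lemma normal_span_below:
  assumes "\<forall>s\<in>S. monic d s" "f \<in> normal_span S (\<lambda>\<nu>. \<nu> \<prec> \<mu>)"
  shows "f \<in> below \<mu>"
proof (rule linear_normal_span[where F = "\<lambda>x. x", OF lb.linear_ident below_subspace assms(2)])
  fix h \<nu> assume \<nu>: "\<nu> \<prec> \<mu>" and "normal S h \<nu>"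
  then have "has_lead \<nu> h" using normal_has_lead assms(1) by blast
  then show "h \<in> below \<mu>"
    using has_lead_lookup(2) \<nu> nf_less_trans unfolding below_def by blast
qed

text \<open>Induction on an upper bound \<mu> for the terms of a representation of \<open>f\<close>:
  the terms at \<mu> are collected into a multiple of one normal polynomial modulo smaller ones. A
  nonzero coefficient makes \<mu> the leading monomial; a zero one lowers the bound.\<close>

lemma reduced_composition_diamond:
  assumes monic: "\<forall>s\<in>S. monic d s" and red: "reduced p d S"
    and f: "f \<in> normal_span S (\<lambda>_. True)" "f \<noteq> 0"
  shows "\<exists>h. normal S h (lead d f)"
proof -
  have "\<exists>h. normal S h (lead d f)" if "f \<in> normal_span S (\<lambda>\<nu>. \<nu> = \<mu> \<or> \<nu> \<prec> \<mu>)" "f \<noteq> 0" for f \<mu>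
    using that
  proof (induction \<mu> arbitrary: f rule: nf_less_induct[where d = d])
    case (less \<mu>)
    let ?V = "normal_span S (\<lambda>\<nu>. \<nu> \<prec> \<mu>)"
    \<comment> \<open>The greatest monomial of a representation below \<mu> is itself below \<mu>,
      so the induction hypothesis applies to it.\<close>
    have smaller: "\<exists>h. normal S h (lead d f)" if "f \<in> ?V"
      using normal_span_less_cases[OF that] less by blast
    show ?case
    proof (cases "\<exists>h. normal S h \<mu>")
      case False
      then have "{h. \<exists>\<nu>. (\<nu> = \<mu> \<or> \<nu> \<prec> \<mu>) \<and> normal S h \<nu>} = {h. \<exists>\<nu>. \<nu> \<prec> \<mu> \<and> normal S h \<nu>}"
        by blast
      then show ?thesis using smaller less.prems(1) by (simp add: normal_span_def)
    next
      case True
      then obtain h where h: "normal S h \<mu>" ..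
      have "\<exists>c. f - lb_scale c h \<in> ?V"
        using less.prems(1) unfolding normal_span_def[of S "\<lambda>\<nu>. \<nu> = \<mu> \<or> \<nu> \<prec> \<mu>"]
      proof (induction rule: lb.span_induct_alt)
        case base
        have "0 - lb_scale 0 h \<in> ?V" using lb.subspace_0[OF normal_span_subspace] by simp
        then show ?case by blast
      next
        case (step a g f)
        then obtain c where c: "f - lb_scale c h \<in> ?V" by blast
        \<comment> \<open>The coefficient is 1 if \<open>g\<close> sits at \<mu>, where all normal
          polynomials agree modulo \<open>?V\<close>, and 0 otherwise.\<close>
        have "\<exists>e. g - lb_scale e h \<in> ?V"
        proof (cases "normal S g \<mu>")
          case True
          then have "g - lb_scale 1 h \<in> ?V"
            using reduced_normal_diff[OF monic red True h] by simp
          then show ?thesis by blast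
        next
          case False
          then have "g - lb_scale 0 h \<in> ?V"
            using step(1) by (auto intro: normal_span_base)
          then show ?thesis by blast
        qed
        then obtain e where "g - lb_scale e h \<in> ?V" by blast
        then have "lb_scale a (g - lb_scale e h) + (f - lb_scale c h) \<in> ?V"
          using c by (intro lb.subspace_add lb.subspace_scale normal_span_subspace)
        then have "lb_scale a g + f - lb_scale (a * e + c) h \<in> ?V"
          by (simp add: lb.scale_right_diff_distrib lb.scale_left_distrib algebra_simps)
        then show ?case by blast
      qed
      then obtain c where c: "f - lb_scale c h \<in> ?V" by blast
      show ?thesis
      proof (cases "c = 0")
        case True
        then show ?thesis using smaller c by simp
      next
        case False
        have hl: "has_lead \<mu> h" using normal_has_lead[OF h monic] .
        have b: "f - lb_scale c h \<in> below \<mu>" using normal_span_below[OF monic c] .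
        have "lead d f = \<mu>"
        proof (rule lead_eqI)
          have "\<mu> \<notin> Poly_Mapping.keys (f - lb_scale c h)" using belowD[OF b] nf_less_irrefl by blast
          then show "\<mu> \<in> Poly_Mapping.keys f"
            using False has_lead_lookup(1)[OF hl] by (auto simp: in_keys_iff lookup_minus)
          fix \<nu> assume \<nu>: "\<nu> \<in> Poly_Mapping.keys f" "\<nu> \<noteq> \<mu>"
          then have "\<nu> \<in> Poly_Mapping.keys (f - lb_scale c h) \<or> \<nu> \<in> Poly_Mapping.keys h"
            by (auto simp: in_keys_iff lookup_minus)
          then show "\<nu> \<prec> \<mu>" using belowD[OF b] has_lead_lookup(2)[OF hl] \<nu> by blast
        qed
        then show ?thesis using h by blast
      qed
    qed
  qed
  then show ?thesis using normal_span_less_cases[OF f(1)] f(2) by blast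
qed


section \<open>The canonical basis of an ideal\<close>

text \<open>Restricting to monic elements loses nothing in a subspace, where nonzero elements can be
  normalized.\<close>

definition leads :: "('x, 'k::field) lb set \<Rightarrow> 'x nf set" where
  "leads I = {\<mu>. \<exists>f\<in>I. has_lead \<mu> f}"

text \<open>The two exclusions mirror the rules \<open>right\<close> and
  \<open>left\<close>.\<close>

definition minimal_leads :: "('x, 'k::field) lb set \<Rightarrow> 'x nf set" where
  "minimal_leads I = {\<mu> \<in> leads I. \<forall>\<nu> b. \<mu> = Snoc \<nu> b \<longrightarrow> \<nu> \<notin> leads I \<and> Letter b \<notin> leads I}"

text \<open>Equivalently, \<open>mon \<mu> - f\<close> is the normal form of \<mu> modulo
  \<open>I\<close>.\<close>

definition canonical_for :: "('x, 'k::field) lb set \<Rightarrow> 'x nf \<Rightarrow> ('x, 'k) lb \<Rightarrow> bool" where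
  "canonical_for I \<mu> f \<longleftrightarrow>
     f \<in> I \<and> has_lead \<mu> f \<and> Poly_Mapping.keys (f - mon \<mu>) \<inter> leads I = {}"

definition canonical_basis :: "('x, 'k::field) lb set \<Rightarrow> ('x, 'k) lb set" where
  "canonical_basis I = {f. \<exists>\<mu>\<in>minimal_leads I. canonical_for I \<mu> f}"

lemma lead_in_leads:
  assumes "lb.subspace I" "f \<in> I" "f \<noteq> 0"
  shows "lead d f \<in> leads I"
  using has_lead_normalize[OF assms(3)] lb.subspace_scale[OF assms(1,2)]
  unfolding leads_def by blast

lemma keys_off_leads_zero:
  assumes "lb.subspace I" "f \<in> I" "Poly_Mapping.keys f \<inter> leads I = {}"
  shows "f = 0"
  using lead_in_leads[OF assms(1,2)] lead_greatest(1)[of f d] assms(3) by blast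

lemma canonical_for_unique:
  assumes I: "lb.subspace I" and f: "canonical_for I \<mu> f" and g: "canonical_for I \<mu> g"
  shows "f = g"
proof -
  let ?U = "{f. Poly_Mapping.keys f \<subseteq> - leads I}"
  have "(f - mon \<mu>) - (g - mon \<mu>) \<in> ?U"
    by (rule lb.subspace_diff[OF keys_subset_subspace])
       (use f g in \<open>auto simp: canonical_for_def\<close>)
  then have "Poly_Mapping.keys (f - g) \<inter> leads I = {}" by auto
  moreover have "f - g \<in> I" using f g lb.subspace_diff[OF I] by (auto simp: canonical_for_def)
  ultimately have "f - g = 0" using keys_off_leads_zero[OF I] by blast
  then show ?thesis by simp
qed

text \<open>Modulo \<open>I\<close>, every monomial below \<mu> is a combination of such monomials
  outside \<open>leads I\<close>; rewriting the tail of an element led by \<mu> in this way yields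
  the canonical one.\<close>

lemma canonical_for_exists:
  fixes I :: "('x, 'k::field) lb set"
  assumes I: "lb.subspace I" and \<mu>: "\<mu> \<in> leads I"
  shows "\<exists>f. canonical_for I \<mu> f"
proof -
  define N where "N = {n :: ('x, 'k) lb. Poly_Mapping.keys n \<subseteq> {\<nu>. \<nu> \<prec> \<mu>} - leads I}"
  \<comment> \<open>\<open>U\<close> collects the elements with a remainder in \<open>N\<close>
    modulo \<open>I\<close>; as a subspace it need only be tested on monomials.\<close>
  define U where "U = {n + f | n f. n \<in> N \<and> f \<in> I}"
  have N: "lb.subspace N" unfolding N_def by (rule keys_subset_subspace)
  have U: "lb.subspace U" unfolding U_def by (rule lb.subspace_sums[OF N I])
  have I_U: "f \<in> U" if "f \<in> I" for f
    unfolding U_def using that lb.subspace_0[OF N] by force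
  have mon_U: "\<kappa> \<prec> \<mu> \<Longrightarrow> mon \<kappa> \<in> U" for \<kappa>
  proof (induction \<kappa> rule: nf_less_induct[where d = d])
    case (less \<kappa>)
    show ?case
    proof (cases "\<kappa> \<in> leads I")
      case False
      then have "mon \<kappa> \<in> N" using less.prems by (simp add: N_def)
      then show ?thesis unfolding U_def using lb.subspace_0[OF I] by force
    next
      case True
      then obtain f where f: "f \<in> I" "f - mon \<kappa> \<in> below \<kappa>"
        by (auto simp: leads_def has_lead_def)
      have "f - mon \<kappa> \<in> U"
      proof (rule in_subspace[OF U])
        fix \<nu> assume "\<nu> \<in> Poly_Mapping.keys (f - mon \<kappa>)"
        then have "\<nu> \<prec> \<kappa>" by (rule belowD[OF f(2)])
        then show "mon \<nu> \<in> U" using less.IH nf_less_trans[OF _ less.prems] by blast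
      qed
      then have "f - (f - mon \<kappa>) \<in> U" by (rule lb.subspace_diff[OF U I_U[OF f(1)]])
      then show ?thesis by simp
    qed
  qed
  obtain f where f: "f \<in> I" "f - mon \<mu> \<in> below \<mu>"
    using \<mu> by (auto simp: leads_def has_lead_def)
  have "f - mon \<mu> \<in> U"
    by (rule in_subspace[OF U mon_U[OF belowD[OF f(2)]]])
  \<comment> \<open>Subtracting \<open>g\<close> stays inside \<open>I\<close> and leaves
    \<open>n\<close> as the tail.\<close>
  then obtain n g where ng: "f - mon \<mu> = n + g" "n \<in> N" "g \<in> I" by (auto simp: U_def)
  have eq: "f - g - mon \<mu> = n" using ng(1) by (simp add: algebra_simps)
  have "canonical_for I \<mu> (f - g)"
    unfolding canonical_for_def has_lead_def eq below_def
    using ng lb.subspace_diff[OF I f(1)] by (auto simp: N_def)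
  then show ?thesis ..
qed

lemma canonical_for_homogeneous:
  assumes I: "lbs.graded_ideal I" and s: "canonical_for I \<mu> s"
  shows "homogeneous p s"
proof -
  have sub: "lb.subspace I" using I by (simp add: lbs.graded_ideal_def lbs.ideal_def)
  have sI: "s \<in> I" using s by (simp add: canonical_for_def)
  then obtain u v where uv: "s = u + v" "u \<in> I" "u \<in> lb_part p 0" "v \<in> I" "v \<in> lb_part p 1"
    using I unfolding lbs.graded_ideal_def by blast
  \<comment> \<open>The monomial \<mu> cannot occur in the component \<open>w'\<close> of the other
    parity, so all monomials of \<open>w'\<close> lie in the tail of \<open>s\<close>.\<close>
  have vanish: "w' = 0"
    if "s = w + w'" "w \<in> lb_part p i" "w' \<in> lb_part p j" "w' \<in> I" "i \<noteq> j" "nf_parity p \<mu> = i" for w w' i j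
  proof (rule keys_off_leads_zero[OF sub that(4)])
    have "\<kappa> \<in> Poly_Mapping.keys (s - mon \<mu>)" if \<kappa>: "\<kappa> \<in> Poly_Mapping.keys w'" for \<kappa>
    proof -
      have "nf_parity p \<kappa> = j" using \<kappa> \<open>w' \<in> lb_part p j\<close> by (auto simp: lb_part_def)
      then have "\<kappa> \<noteq> \<mu>" "\<kappa> \<notin> Poly_Mapping.keys w"
        using \<open>i \<noteq> j\<close> \<open>nf_parity p \<mu> = i\<close> \<open>w \<in> lb_part p i\<close> by (auto simp: lb_part_def)
      then show ?thesis
        using \<kappa> \<open>s = w + w'\<close> by (simp add: in_keys_iff lookup_minus lookup_add lookup_mon)
    qed
    then show "Poly_Mapping.keys w' \<inter> leads I = {}"
      using s by (auto simp: canonical_for_def)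
  qed
  have "u = 0 \<or> v = 0"
    using bit_eq_0_or_1[of "nf_parity p \<mu>"]
  proof
    assume "nf_parity p \<mu> = 0"
    then show ?thesis using vanish[of u v 0 1] uv by auto
  next
    assume "nf_parity p \<mu> = 1"
    then show ?thesis using vanish[of v u 1 0] uv by (auto simp: add.commute)
  qed
  then show ?thesis using uv by (auto simp: homogeneous_def)
qed

section \<open>Existence: division by the canonical basis\<close>

lemma normal_leads:
  assumes "lbs.ideal I" "S \<subseteq> I" "\<forall>s\<in>S. monic d s" "normal S h \<mu>"
  shows "\<mu> \<in> leads I"
  using normal_in_ideal[OF assms(4,1,2)] normal_has_lead[OF assms(4,3)] by (auto simp: leads_def)

lemma canonical_basis_subset: "canonical_basis I \<subseteq> I"
  by (auto simp: canonical_basis_def canonical_for_def)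

lemma canonical_basis_monic: "\<forall>s\<in>canonical_basis I. monic d s"
  by (auto simp: canonical_basis_def canonical_for_def intro: has_lead_monic)

lemma canonical_basis_normal:
  assumes I: "lb.subspace I"
  shows "\<mu> \<in> leads I \<Longrightarrow> \<exists>h. normal (canonical_basis I) h \<mu>"
proof (induction \<mu>)
  have minimal: "\<exists>s\<in>canonical_basis I. lead d s = \<mu>" if "\<mu> \<in> minimal_leads I" for \<mu>
  proof -
    have "\<mu> \<in> leads I" using that by (simp add: minimal_leads_def)
    from canonical_for_exists[OF I this] obtain s where s: "canonical_for I \<mu> s" ..
    then have "lead d s = \<mu>" by (simp add: canonical_for_def has_lead_lead)
    then show ?thesis using s that by (auto simp: canonical_basis_def)
  qed
  {
    case (Letter b)
    then have "Letter b \<in> minimal_leads I" by (simp add: minimal_leads_def)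
    then show ?case using minimal normal.base by metis
  next
    case (Snoc \<nu> b)
    consider "\<nu> \<in> leads I" | "Letter b \<in> leads I" | "Snoc \<nu> b \<in> minimal_leads I"
      using Snoc.prems by (auto simp: minimal_leads_def)
    then show ?case
    proof cases
      case 1
      then show ?thesis using Snoc.IH normal.right by blast
    next
      \<comment> \<open>A leading letter has no proper prefix, so it is minimal and belongs to a
        basis element, as \<open>left\<close> requires.\<close>
      case 2
      then have "Letter b \<in> minimal_leads I" by (simp add: minimal_leads_def)
      then show ?thesis using minimal normal.left by metis
    next
      case 3
      then show ?thesis using minimal normal.base by metis
    qed
  }
qed

text \<open>This is division: a normal polynomial with the same leading monomial cancels the leading
  term of \<open>f\<close>. As \<open>P\<close> is closed downwards, it persists; it will be a bound
  in the order, a bound on the degree, or \<open>True\<close>.\<close>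

lemma canonical_basis_span:
  assumes I: "lbs.ideal I" and P: "\<And>\<mu> \<nu>. \<nu> \<prec> \<mu> \<Longrightarrow> P \<mu> \<Longrightarrow> P \<nu>"
    and f: "f \<in> I" "\<forall>\<kappa>\<in>Poly_Mapping.keys f. P \<kappa>"
  shows "f \<in> normal_span (canonical_basis I) P"
proof -
  have sub: "lb.subspace I" using I by (simp add: lbs.ideal_def)
  have below: "f \<in> normal_span (canonical_basis I) P"
    if "f \<in> I" "f \<in> below \<mu>" "\<forall>\<kappa>\<in>Poly_Mapping.keys f. P \<kappa>" for f \<mu>
    using that
  proof (induction \<mu> arbitrary: f rule: nf_less_induct[where d = d])
    case (less \<mu>)
    show ?case
    proof (cases "f = 0")
      case True
      then show ?thesis using lb.subspace_0[OF normal_span_subspace] by simp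
    next
      case False
      define \<kappa> c where "\<kappa> = lead d f" and "c = Poly_Mapping.lookup f \<kappa>"
      have \<kappa>: "\<kappa> \<in> Poly_Mapping.keys f" "\<And>\<nu>. \<nu> \<in> Poly_Mapping.keys f \<Longrightarrow> \<nu> \<noteq> \<kappa> \<Longrightarrow> \<nu> \<prec> \<kappa>"
        using lead_greatest[OF False, where d = d] by (auto simp: \<kappa>_def)
      have "P \<kappa>" "\<kappa> \<prec> \<mu>" using \<kappa> less.prems belowD by blast+
      have "\<kappa> \<in> leads I" unfolding \<kappa>_def by (rule lead_in_leads[OF sub less.prems(1) False])
      then obtain h where h: "normal (canonical_basis I) h \<kappa>"
        using canonical_basis_normal[OF sub] by blast
      have hl: "has_lead \<kappa> h" by (rule normal_has_lead[OF h canonical_basis_monic])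
      have hI: "h \<in> I" by (rule normal_in_ideal[OF h I canonical_basis_subset])
      have low: "f - lb_scale c h \<in> below \<kappa>"
        unfolding below_def
      proof (intro CollectI subsetI)
        fix \<nu> assume \<nu>: "\<nu> \<in> Poly_Mapping.keys (f - lb_scale c h)"
        then have "\<nu> \<noteq> \<kappa>"
          using has_lead_lookup(1)[OF hl] by (auto simp: in_keys_iff lookup_minus c_def)
        moreover have "\<nu> \<in> Poly_Mapping.keys f \<or> \<nu> \<in> Poly_Mapping.keys h"
          using \<nu> by (auto simp: in_keys_iff lookup_minus)
        ultimately show "\<nu> \<prec> \<kappa>" using \<kappa>(2) has_lead_lookup(2)[OF hl] by blast
      qed
      have "f - lb_scale c h \<in> normal_span (canonical_basis I) P"
      proof (rule less.IH[OF \<open>\<kappa> \<prec> \<mu>\<close> _ low])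
        show "f - lb_scale c h \<in> I"
          by (intro lb.subspace_diff lb.subspace_scale sub less.prems hI)
        show "\<forall>\<nu>\<in>Poly_Mapping.keys (f - lb_scale c h). P \<nu>"
          using belowD[OF low] P \<open>P \<kappa>\<close> by blast
      qed
      moreover have "lb_scale c h \<in> normal_span (canonical_basis I) P"
        by (intro lb.subspace_scale normal_span_subspace normal_span_base[OF h] \<open>P \<kappa>\<close>)
      ultimately have "f - lb_scale c h + lb_scale c h \<in> normal_span (canonical_basis I) P"
        by (rule lb.subspace_add[OF normal_span_subspace])
      then show ?thesis by simp
    qed
  qed
  \<comment> \<open>Division starts from a strict bound on the support, here the leading monomial
    with a letter appended; for \<open>f = 0\<close> the bound is vacuous.\<close>
  have "f \<in> below (Snoc (lead d f) b)" for b
    unfolding below_def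
    using lead_greatest(2)[of f _ d] nf_less_Snoc[of d "lead d f" b] nf_less_trans by fastforce
  then show ?thesis using below f by blast
qed

text \<open>The elements required to be trivial lie in \<open>I\<close>, so division makes them
  trivial, with the bound read off from their supports.\<close>

lemma canonical_basis_reduced_gs_basis:
  fixes I :: "('x, 'k::field) lb set"
  assumes I: "lbs.graded_ideal I"
  shows "reduced_gs_basis_for p d I (canonical_basis I)"
proof -
  let ?S = "canonical_basis I"
  have ideal: "lbs.ideal I" using I by (simp add: lbs.graded_ideal_def)
  then have sub: "lb.subspace I" by (simp add: lbs.ideal_def)
  have "gs_basis p d ?S"
    unfolding gs_basis_def trivial_below_iff[OF canonical_basis_monic]
      trivial_upto_deg_iff[OF canonical_basis_monic]
  proof (intro conjI ballI allI impI)
    fix s assume "s \<in> ?S"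
    then show "monic d s" "homogeneous p s"
      using canonical_basis_monic canonical_for_homogeneous[OF I]
      by (auto simp: canonical_basis_def)
  next
    fix f g h assume f: "f \<in> ?S" and "g \<in> ?S" "h \<in> normal_polys_of p d g" and eq: "lead d f = lead d h"
    then obtain \<mu> where h: "normal ?S h \<mu>"
      using normal_polys_iff[of h ?S] by (auto simp: normal_polys_def)
    have hl: "has_lead (lead d f) h"
      using normal_has_lead[OF h canonical_basis_monic] has_lead_lead eq by metis
    have "f - h \<in> below (lead d f)"
      using has_lead_diff_below[OF monic_has_lead hl] f canonical_basis_monic by blast
    moreover have "f - h \<in> I"
      using f normal_in_ideal[OF h ideal canonical_basis_subset] canonical_basis_subset
      by (blast intro: lb.subspace_diff[OF sub])
    ultimately show "f - h \<in> normal_span ?S (\<lambda>\<nu>. \<nu> \<prec> lead d f)"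
      by (intro canonical_basis_span[OF ideal]) (auto dest: belowD intro: nf_less_trans)
  next
    fix f \<mu> assume f: "f \<in> ?S"
    let ?n = "nf_deg d \<mu> + nf_deg d (lead d f)"
    have nz: "f \<noteq> 0" using f canonical_basis_monic by (auto simp: monic_def)
    have "mon \<mu> \<cdot> f \<in> {g. Poly_Mapping.keys g \<subseteq> {\<kappa>. nf_deg d \<kappa> \<le> ?n}}"
    proof (rule linear_in_subspace[OF lb_mult_linear_right keys_subset_subspace])
      fix \<kappa> assume "\<kappa> \<in> Poly_Mapping.keys f"
      then have "nf_deg d \<kappa> \<le> nf_deg d (lead d f)"
        using lead_greatest(2)[OF nz, of \<kappa> d] nf_less_deg_le by blast
      then show "mon \<mu> \<cdot> mon \<kappa> \<in> {g. Poly_Mapping.keys g \<subseteq> {\<kappa>. nf_deg d \<kappa> \<le> ?n}}"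
        using keys_nf_mult[of p \<mu> \<kappa> d] by (auto simp: lb_mult_mono)
    qed
    moreover have "mon \<mu> \<cdot> f \<in> I"
      using f canonical_basis_subset ideal unfolding lbs.ideal_def by blast
    ultimately show "mon \<mu> \<cdot> f \<in> normal_span ?S (\<lambda>\<nu>. nf_deg d \<nu> \<le> ?n)"
      by (intro canonical_basis_span[OF ideal]) (auto dest: nf_less_deg_le)
  qed
  moreover have "reduced p d ?S"
    unfolding reduced_def
  proof (intro ballI subsetI)
    fix s \<kappa> assume s: "s \<in> ?S" and \<kappa>: "\<kappa> \<in> Poly_Mapping.keys s"
    then obtain \<mu> where \<mu>: "\<mu> \<in> minimal_leads I" "canonical_for I \<mu> s"
      by (auto simp: canonical_basis_def)
    have monic: "\<forall>t\<in>?S - {s}. monic d t" using canonical_basis_monic by blast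
    have leads: "\<nu> \<in> leads I" if "normal (?S - {s}) h \<nu>" for h \<nu>
      using normal_leads[OF ideal _ monic that] canonical_basis_subset by blast
    \<comment> \<open>A monomial of \<open>s\<close> reached from the other elements is in
      \<open>leads I\<close>, hence is \<mu>; minimality excludes \<open>left\<close> and
      \<open>right\<close>, and uniqueness of canonical elements excludes
      \<open>base\<close>.\<close>
    have "\<not> normal (?S - {s}) h \<kappa>" for h
    proof
      assume h: "normal (?S - {s}) h \<kappa>"
      then have "\<kappa> \<notin> Poly_Mapping.keys (s - mon \<mu>)"
        using \<mu>(2) leads by (auto simp: canonical_for_def)
      then have "\<kappa> = \<mu>" using \<kappa> by (auto simp: in_keys_iff lookup_minus lookup_mon split: if_splits)
      from h show False
      proof cases
        case base
        then obtain \<nu> where \<nu>: "canonical_for I \<nu> h" by (auto simp: canonical_basis_def)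
        then have "lead d h = \<nu>" by (simp add: canonical_for_def has_lead_lead)
        then have "\<nu> = \<mu>" using base \<open>\<kappa> = \<mu>\<close> by simp
        then have "h = s" using canonical_for_unique[OF sub] \<nu> \<mu>(2) by blast
        then show False using base by simp
      next
        case (left t b \<nu>)
        then have "Letter b \<in> leads I" using leads[OF normal.base[OF left(3)]] by simp
        then show False using \<mu>(1) left \<open>\<kappa> = \<mu>\<close> by (auto simp: minimal_leads_def)
      next
        case (right g \<nu> b)
        then show False using \<mu>(1) leads[OF right(3)] \<open>\<kappa> = \<mu>\<close> by (auto simp: minimal_leads_def)
      qed
    qed
    then show "\<kappa> \<in> Irr p d (?S - {s})" by (simp add: Irr_iff[OF monic])
  qed
  moreover have "lbs.ideal_generated ?S = I"
    unfolding ideal_generated_eq_normal_span[OF \<open>gs_basis p d ?S\<close>]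
  proof
    show "normal_span ?S (\<lambda>_. True) \<subseteq> I"
      unfolding normal_span_def
      by (rule lb.span_minimal) (auto intro: normal_in_ideal[OF _ ideal canonical_basis_subset] sub)
    show "I \<subseteq> normal_span ?S (\<lambda>_. True)"
      by (auto intro: canonical_basis_span[OF ideal])
  qed
  ultimately show ?thesis by (simp add: reduced_gs_basis_for_def)
qed

section \<open>Uniqueness, and the purely even case\<close>

lemma reduced_gs_basis_canonical:
  fixes I :: "('x, 'k::field) lb set"
  assumes ideal: "lbs.ideal I" and S: "reduced_gs_basis_for p d I S"
  shows "S = canonical_basis I"
proof -
  have gs: "gs_basis p d S" and red: "reduced p d S" and gen: "lbs.ideal_generated S = I"
    using S by (auto simp: reduced_gs_basis_for_def)
  have monic: "\<forall>s\<in>S. monic d s" using gs by (auto simp: gs_basis_def)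
  have sub: "lb.subspace I" using ideal by (simp add: lbs.ideal_def)
  have I: "I = normal_span S (\<lambda>_. True)"
    using ideal_generated_eq_normal_span[OF gs] gen by simp
  have SI: "S \<subseteq> I" unfolding I by (auto intro: normal_span_base normal.base)
  have leads_iff: "\<mu> \<in> leads I \<longleftrightarrow> (\<exists>h. normal S h \<mu>)" for \<mu>
  proof
    assume "\<mu> \<in> leads I"
    then obtain f where "f \<in> I" "has_lead \<mu> f" by (auto simp: leads_def)
    then show "\<exists>h. normal S h \<mu>"
      using reduced_composition_diamond[OF monic red, of f] has_lead_lead has_lead_nonzero I by blast
  qed (use normal_leads[OF ideal SI monic] in blast)
  have irreducible: "\<not> normal (S - {s}) h \<kappa>" if "s \<in> S" "\<kappa> \<in> Poly_Mapping.keys s" for s h \<kappa>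
    using red that monic Irr_iff[of "S - {s}" \<kappa>] unfolding reduced_def by blast
  \<comment> \<open>Normal polynomials built from \<open>s\<close> have monomials no smaller than
    \<open>lead d s\<close>, so those strictly below come from the other elements, where reducedness
    applies.\<close>
  have other: "normal (S - {s}) h \<kappa>" if h: "normal S h \<kappa>" and \<kappa>: "\<kappa> \<prec> lead d s" for s h \<kappa>
  proof -
    obtain t where t: "t \<in> S" "normal {t} h \<kappa>" using normal_singleton[OF h] by blast
    have "t \<noteq> s" using normal_singleton_cases[OF t(2)] \<kappa> nf_less_asym nf_less_irrefl by blast
    then show ?thesis using t normal_mono[OF t(2), of "S - {s}"] by blast
  qed
  have canonical: "lead d s \<in> minimal_leads I \<and> canonical_for I (lead d s) s" if s: "s \<in> S" for s
  proof
    have hl: "has_lead (lead d s) s" using monic s monic_has_lead by blast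
    have lead_key: "lead d s \<in> Poly_Mapping.keys s"
      using has_lead_lookup(1)[OF hl] by (simp add: in_keys_iff)
    have "Poly_Mapping.keys (s - mon (lead d s)) \<inter> leads I = {}"
    proof (intro equals0I)
      fix \<kappa> assume \<kappa>: "\<kappa> \<in> Poly_Mapping.keys (s - mon (lead d s)) \<inter> leads I"
      then have lt: "\<kappa> \<prec> lead d s" using hl belowD by (auto simp: has_lead_def)
      then have "\<kappa> \<in> Poly_Mapping.keys s"
        using \<kappa> by (auto simp: in_keys_iff lookup_minus lookup_mon split: if_splits)
      moreover obtain h where "normal S h \<kappa>" using \<kappa> leads_iff by blast
      ultimately show False using irreducible[OF s] other lt by blast
    qed
    then show "canonical_for I (lead d s) s"
      using s SI hl by (auto simp: canonical_for_def)
    show "lead d s \<in> minimal_leads I"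
      unfolding minimal_leads_def
    proof (intro CollectI conjI allI impI)
      show "lead d s \<in> leads I" using leads_iff normal.base[OF s] by blast
      fix \<nu> b assume eq: "lead d s = Snoc \<nu> b"
      show "\<nu> \<notin> leads I"
      proof
        assume "\<nu> \<in> leads I"
        then obtain h where "normal S h \<nu>" using leads_iff by blast
        then have "normal (S - {s}) h \<nu>" using other nf_less_Snoc eq by metis
        then have "normal (S - {s}) (h \<cdot> gen b) (lead d s)" unfolding eq by (rule normal.right)
        then show False using irreducible[OF s lead_key] by blast
      qed
      show "Letter b \<notin> leads I"
      proof
        assume "Letter b \<in> leads I"
        then obtain h where "normal S h (Letter b)" using leads_iff by blast
        then have "normal (S - {s}) h (Letter b)" using other nf_less_Letter_Snoc eq by metis
        \<comment> \<open>A normal polynomial with a one-letter monomial is a member of the set, so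
          \<open>left\<close> applies to it.\<close>
        then have "normal (S - {s}) (mon \<nu> \<cdot> h) (lead d s)"
          unfolding eq by cases (auto intro: normal.left)
        then show False using irreducible[OF s lead_key] by blast
      qed
    qed
  qed
  show ?thesis
  proof (intro equalityI subsetI)
    fix s assume "s \<in> S"
    then show "s \<in> canonical_basis I" using canonical by (auto simp: canonical_basis_def)
  next
    fix f assume "f \<in> canonical_basis I"
    then obtain \<mu> where \<mu>: "\<mu> \<in> minimal_leads I" "canonical_for I \<mu> f"
      by (auto simp: canonical_basis_def)
    then obtain h where h: "normal S h \<mu>" using leads_iff by (auto simp: minimal_leads_def)
    \<comment> \<open>Minimality of \<mu> excludes \<open>left\<close> and \<open>right\<close>, so
      \<open>h\<close> is in \<open>S\<close> and, being canonical, equals \<open>f\<close>.\<close>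
    then show "f \<in> S"
    proof cases
      case base
      then have "canonical_for I \<mu> h" using canonical by blast
      then have "f = h" using canonical_for_unique[OF sub] \<mu>(2) by blast
      then show ?thesis using base by simp
    next
      case (left t b \<nu>)
      then have "Letter b \<in> leads I" using leads_iff normal.base[OF left(3)] by metis
      then show ?thesis using \<mu>(1) left by (auto simp: minimal_leads_def)
    next
      case (right g \<nu> b)
      then show ?thesis using \<mu>(1) leads_iff by (auto simp: minimal_leads_def)
    qed
  qed
qed

lemma graded_ideal_unique_reduced_gs_basis:
  fixes I :: "('x, 'k::field) lb set"
  assumes "lbs.graded_ideal I"
  shows "\<exists>!S. reduced_gs_basis_for p d I S"
  using canonical_basis_reduced_gs_basis[OF assms] reduced_gs_basis_canonical[of I] assms
  unfolding lbs.graded_ideal_def by blast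

text \<open>The odd part is zero, so every element is its own even component.\<close>

lemma even_ideal_graded:
  fixes I :: "('x, 'k::field) lb set"
  assumes even: "\<forall>x. p x = 0" and I: "lbs.ideal I"
  shows "lbs.graded_ideal I"
proof -
  have "lb_part p 0 = (UNIV :: ('x, 'k) lb set)" using even by (intro lb_part_even) simp
  moreover from this have "lb_part p 1 = ({0} :: ('x, 'k) lb set)" using lbs.part_Int by auto
  moreover have "0 \<in> I" using I lb.subspace_0 by (auto simp: lbs.ideal_def)
  ultimately show ?thesis using I by (auto simp: lbs.graded_ideal_def)
qed

end

theorem theorem4p15:
  fixes p :: "'x::wellorder \<Rightarrow> bit" and d :: "'x \<Rightarrow> nat"
  assumes "\<And>x. d x > 0"
  shows "(\<forall>I :: ('x, 'k::field) lb set.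
            superalgebra.graded_ideal lb_scale (lb_mult p) (lb_part p) I \<longrightarrow>
            (\<exists>!S. reduced_gs_basis_for p d I S)) \<and>
         ((\<forall>x. p x = 0) \<longrightarrow>
            (\<forall>I :: ('x, 'k) lb set. superalgebra.ideal lb_scale (lb_mult p) I \<longrightarrow>
            (\<exists>!S. reduced_gs_basis_for p d I S)))"
  using graded_ideal_unique_reduced_gs_basis even_ideal_graded by blast

end
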